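(* Let $\mathcal{T}=\mathbb{R}[\varepsilon]/(\varepsilon^3)$, and let $\Psi_{\mathcal{T}}:\mathbb{P}(\mathcal{H}^2)\to\mathcal{T}$ be the density map $$\Psi_{\mathcal{T}}(\rho)=\left(\tfrac12+x\right)+y\,\varepsilon+z\,\varepsilon^2,\qquad x=\mathrm{Tr}(\rho\sigma_x),\ y=\mathrm{Tr}(\rho\sigma_y),\ z=\mathrm{Tr}(\rho\sigma_z).$$ Then $\Psi_{\mathcal{T}}$ is a global smooth embedding, and it is a diffeomorphism from the complex projective space $\mathbb{P}(\mathcal{H}^2)$ onto the compact sphere $$\mathcal{S}^2_{\mathcal{T}}=\left\{\left(\tfrac12+x\right)+y\varepsilon+z\varepsilon^2\in\mathbb{R}[\varepsilon]/(\varepsilon^3)\ \middle|\ x^2+y^2+z^2=1\right\}$$ centered at the coordinate point $(\tfrac12,0,0)$. Moreover, when restricted to the tangent bundle $T\mathcal{S}^2_{\mathcal{T}}$, the Euclidean metric $\mathrm{d}s^2_{\mathcal{T}}=\mathrm{d}x^2+\mathrm{d}y^2+\mathrm{d}z^2$ corresponds under $\Psi_{\mathcal{T}}$ to the Fubini–Study metric $\mathrm{d}s^2_{\mathrm{FS}}$ on $\mathbb{P}(\mathcal{H}^2)$ via $$\mathrm{d}s^2_{\mathcal{T}}=4\,\mathrm{d}s^2_{\mathrm{FS}}.$$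
   Context: $\mathcal{H}^2=\mathbb{C}^2$, and $\mathbb{P}(\mathcal{H}^2)\cong\mathbb{CP}^1$ is the space of complex lines in $\mathbb{C}^2$. A point of $\mathbb{P}(\mathcal{H}^2)$, represented by a unit vector $|\psi\rangle$, is identified with the rank-one Hermitian projector $\rho=|\psi\rangle\langle\psi|$. The matrices $\sigma_x,\sigma_y,\sigma_z$ are the Pauli matrices, so $\rho=\frac12(\mathbb{I}_2+x\sigma_x+y\sigma_y+z\sigma_z)$. The Fubini–Study metric is normalized as $\mathrm{d}s^2_{\mathrm{FS}}=\langle \mathrm{d}\psi|\mathrm{d}\psi\rangle-|\langle\psi|\mathrm{d}\psi\rangle|^2=\frac12\mathrm{Tr}(\mathrm{d}\rho\,\mathrm{d}\rho)$. The three-dimensional real vector space $\mathcal{T}$ carries the Euclidean inner product for which the monomial basis $\{1,\varepsilon,\varepsilon^2\}$ is orthonormal. *)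

theory Defs
  imports "HOL-Analysis.Analysis" "HOL-Computational_Algebra.Polynomial"
begin

section \<open>Smooth maps between Euclidean spaces\<close>

text \<open>\<open>S\<close> is meant to be open: all derivatives are taken at interior points.\<close>

primrec higher_differentiable_on ::
    "'a::real_normed_vector set \<Rightarrow> ('a \<Rightarrow> 'b::real_normed_vector) \<Rightarrow> nat \<Rightarrow> bool" where
  "higher_differentiable_on S f 0 \<longleftrightarrow> continuous_on S f"
| "higher_differentiable_on S f (Suc n) \<longleftrightarrow>
     (\<forall>x\<in>S. f differentiable (at x)) \<and>
     (\<forall>v. higher_differentiable_on S (\<lambda>x. frechet_derivative f (at x) v) n)"

definition smooth_on :: "'a::real_normed_vector set \<Rightarrow> ('a \<Rightarrow> 'b::real_normed_vector) \<Rightarrow> bool" where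
  "smooth_on S f \<longleftrightarrow> (\<forall>n. higher_differentiable_on S f n)"

section \<open>Smooth manifolds\<close>

text \<open>A chart is a domain together with a coordinate function that is only relevant on
  that domain; the dimension of a manifold is that of its model space \<open>'e\<close>. The
  topology is the subspace topology of the ambient type.\<close>

type_synonym ('a, 'e) chart = "'a set \<times> ('a \<Rightarrow> 'e)"

record ('a, 'e) manifold =
  points :: "'a set"
  charts :: "('a, 'e) chart set"

abbreviation chart_inv :: "('a, 'e) chart \<Rightarrow> 'e \<Rightarrow> 'a" where
  "chart_inv c \<equiv> inv_into (fst c) (snd c)"

definition smooth_manifold ::
    "('a::topological_space, 'e::euclidean_space) manifold \<Rightarrow> bool" where
  "smooth_manifold M \<longleftrightarrow>
     Hausdorff_space (top_of_set (points M)) \<and>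
     second_countable (top_of_set (points M)) \<and>
     (\<Union>c\<in>charts M. fst c) = points M \<and>
     (\<forall>c\<in>charts M.
        openin (top_of_set (points M)) (fst c) \<and> open (snd c ` fst c) \<and>
        homeomorphism (fst c) (snd c ` fst c) (snd c) (chart_inv c)) \<and>
     (\<forall>c\<in>charts M. \<forall>d\<in>charts M.
        smooth_on (snd c ` (fst c \<inter> fst d)) (snd d \<circ> chart_inv c))"

definition smooth_map ::
    "('a::topological_space, 'e::euclidean_space) manifold \<Rightarrow>
     ('b::topological_space, 'f::euclidean_space) manifold \<Rightarrow> ('a \<Rightarrow> 'b) \<Rightarrow> bool" where
  "smooth_map M N f \<longleftrightarrow>
     f ` points M \<subseteq> points N \<and> continuous_on (points M) f \<and>
     (\<forall>c\<in>charts M. \<forall>d\<in>charts N.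
        smooth_on (snd c ` (fst c \<inter> f -` fst d)) (snd d \<circ> f \<circ> chart_inv c))"

definition diffeomorphism ::
    "('a::topological_space, 'e::euclidean_space) manifold \<Rightarrow>
     ('b::topological_space, 'f::euclidean_space) manifold \<Rightarrow> ('a \<Rightarrow> 'b) \<Rightarrow> bool" where
  "diffeomorphism M N f \<longleftrightarrow>
     smooth_manifold M \<and> smooth_manifold N \<and>
     bij_betw f (points M) (points N) \<and>
     smooth_map M N f \<and> smooth_map N M (inv_into (points M) f)"

subsection \<open>Tangent vectors and differentials\<close>

definition charts_at :: "('a, 'e) manifold \<Rightarrow> 'a \<Rightarrow> ('a, 'e) chart set" where
  "charts_at M p = {c \<in> charts M. p \<in> fst c}"

text \<open>A tangent vector at \<open>p\<close> is a family of coordinate vectors, one for each chart around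
  \<open>p\<close>, that transforms by the Jacobians of the coordinate changes.\<close>

definition tangent_space ::
    "('a, 'e::euclidean_space) manifold \<Rightarrow> 'a \<Rightarrow> (('a, 'e) chart \<Rightarrow> 'e) set" where
  "tangent_space M p =
     {v. (\<forall>c\<in>charts_at M p. \<forall>d\<in>charts_at M p.
            v d = frechet_derivative (snd d \<circ> chart_inv c) (at (snd c p)) (v c)) \<and>
         (\<forall>c. c \<notin> charts_at M p \<longrightarrow> v c = 0)}"

text \<open>By the chain rule the differential does not depend on the chosen chart \<open>c\<close>.\<close>

definition differential ::
    "('a, 'e::euclidean_space) manifold \<Rightarrow> ('b, 'f::euclidean_space) manifold \<Rightarrow>
     ('a \<Rightarrow> 'b) \<Rightarrow> 'a \<Rightarrow> (('a, 'e) chart \<Rightarrow> 'e) \<Rightarrow> (('b, 'f) chart \<Rightarrow> 'f)" where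
  "differential M N f p v =
     (let c = (SOME c. c \<in> charts_at M p)
      in (\<lambda>d. if d \<in> charts_at N (f p)
              then frechet_derivative (snd d \<circ> f \<circ> chart_inv c) (at (snd c p)) (v c)
              else 0))"

definition smooth_embedding ::
    "('a::topological_space, 'e::euclidean_space) manifold \<Rightarrow>
     ('b::topological_space, 'f::euclidean_space) manifold \<Rightarrow> ('a \<Rightarrow> 'b) \<Rightarrow> bool" where
  "smooth_embedding M N f \<longleftrightarrow>
     smooth_manifold M \<and> smooth_manifold N \<and> smooth_map M N f \<and>
     (\<forall>p\<in>points M. inj_on (differential M N f p) (tangent_space M p)) \<and>
     homeomorphism (points M) (f ` points M) f (inv_into (points M) f)"

subsection \<open>Euclidean spaces, open subsets and embedded submanifolds\<close>

definition euclidean_manifold :: "('a::euclidean_space, 'a) manifold" where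
  "euclidean_manifold = \<lparr>points = UNIV, charts = {(UNIV, \<lambda>x. x)}\<rparr>"

text \<open>The canonical identification of the tangent spaces of a Euclidean space with the space.\<close>

definition euclidean_vector :: "(('a, 'a::euclidean_space) chart \<Rightarrow> 'a) \<Rightarrow> 'a" where
  "euclidean_vector v = v (UNIV, \<lambda>x. x)"

definition open_submanifold :: "('a, 'e) manifold \<Rightarrow> 'a set \<Rightarrow> ('a, 'e) manifold" where
  "open_submanifold M U =
     \<lparr>points = points M \<inter> U, charts = (\<lambda>c. (fst c \<inter> U, snd c)) ` charts M\<rparr>"

text \<open>The smooth structure induced on a subset of a Euclidean space: its charts are the
  inverses of smooth parametrisations of relatively open pieces, a chart being smooth when it
  extends locally to a smooth map of the ambient space. The subset is an embedded submanifold
  (of dimension that of \<open>'e\<close>) when such charts cover it, which is part of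
  \<open>smooth_manifold\<close>.\<close>

definition submanifold ::
    "'a::euclidean_space set \<Rightarrow> ('a, 'e::euclidean_space) manifold" where
  "submanifold S =
     \<lparr>points = S,
      charts = {c. openin (top_of_set S) (fst c) \<and> inj_on (snd c) (fst c) \<and>
                   open (snd c ` fst c) \<and> smooth_on (snd c ` fst c) (chart_inv c) \<and>
                   (\<forall>x\<in>fst c. \<exists>W g. open W \<and> x \<in> W \<and> smooth_on W g \<and>
                                    (\<forall>y\<in>W \<inter> fst c. g y = snd c y))}\<rparr>"

section \<open>The complex projective line\<close>

typedef cp1 = "{L :: (complex^2) set. vec.subspace L \<and> vec.dim L = 1}"
  morphisms line_of Abs_cp1
proof -
  have "vec.dim (vec.span {axis 1 1 :: complex^2}) = 1"
    using vec.dim_eq_card_independent[of "{axis 1 1 :: complex^2}"]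
    by (simp add: vec.dim_span vec.independent_insert axis_eq_0_iff)
  then show ?thesis
    using vec.subspace_span by blast
qed

lemma span_in_cp1:
  fixes v :: "complex^2"
  assumes "v \<noteq> 0"
  shows "vec.subspace (vec.span {v}) \<and> vec.dim (vec.span {v}) = 1"
  using assms vec.dim_eq_card_independent[of "{v}"]
  by (simp add: vec.dim_span vec.independent_insert vec.subspace_span)

definition proj_point :: "complex^2 \<Rightarrow> cp1" where
  "proj_point v = Abs_cp1 (vec.span {v})"

text \<open>The quotient topology under \<open>proj_point\<close> on the nonzero vectors.\<close>

instantiation cp1 :: topological_space
begin

definition open_cp1 :: "cp1 set \<Rightarrow> bool" where
  "open_cp1 U \<longleftrightarrow> open {v. v \<noteq> 0 \<and> proj_point v \<in> U}"

instance
proof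
  show "open (UNIV :: cp1 set)"
    unfolding open_cp1_def by (simp add: open_Collect_neq)
next
  fix S T :: "cp1 set"
  assume "open S" "open T"
  moreover have "{v. v \<noteq> 0 \<and> proj_point v \<in> S \<inter> T} =
      {v. v \<noteq> 0 \<and> proj_point v \<in> S} \<inter> {v. v \<noteq> 0 \<and> proj_point v \<in> T}"
    by auto
  ultimately show "open (S \<inter> T)"
    unfolding open_cp1_def by (simp add: open_Int)
next
  fix K :: "cp1 set set"
  assume "\<forall>S\<in>K. open S"
  moreover have "{v. v \<noteq> 0 \<and> proj_point v \<in> \<Union>K} = (\<Union>S\<in>K. {v. v \<noteq> 0 \<and> proj_point v \<in> S})"
    by auto
  ultimately show "open (\<Union>K)"
    unfolding open_cp1_def by (simp add: open_UN)
qed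

end

definition affine_domain :: "2 \<Rightarrow> cp1 set" where
  "affine_domain i = {p. \<exists>v\<in>line_of p. v $ i \<noteq> 0}"

text \<open>The affine coordinate $v_j / v_i$.\<close>

definition affine_coord :: "2 \<Rightarrow> 2 \<Rightarrow> cp1 \<Rightarrow> complex" where
  "affine_coord i j p = (THE z. \<forall>v\<in>line_of p. v $ j = z * v $ i)"

definition CP1 :: "(cp1, complex) manifold" where
  "CP1 = \<lparr>points = UNIV,
          charts = {(affine_domain 1, affine_coord 1 2), (affine_domain 2, affine_coord 2 1)}\<rparr>"

subsection \<open>Rank-one projectors\<close>

definition braket :: "complex^2 \<Rightarrow> complex^2 \<Rightarrow> complex" where
  "braket \<phi> \<psi> = (\<Sum>i\<in>UNIV. cnj (\<phi> $ i) * \<psi> $ i)"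

definition ketbra :: "complex^2 \<Rightarrow> complex^2 \<Rightarrow> complex^2^2" where
  "ketbra \<phi> \<psi> = (\<chi> i j. \<phi> $ i * cnj (\<psi> $ j))"

definition projector :: "cp1 \<Rightarrow> complex^2^2" where
  "projector p = (THE \<rho>. \<forall>\<psi>\<in>line_of p. norm \<psi> = 1 \<longrightarrow> \<rho> = ketbra \<psi> \<psi>)"

lemma norm_smult_vec:
  fixes v :: "complex^2"
  shows "norm (c *s v) = cmod c * norm v"
  unfolding norm_vec_def vector_scalar_mult_def
  by (simp add: norm_mult L2_set_right_distrib)

lemma line_of_span:
  assumes "\<psi> \<in> line_of p" "\<psi> \<noteq> 0"
  shows "line_of p = vec.span {\<psi>}"
proof (rule vec.subspace_dim_equal[symmetric])
  show "vec.subspace (vec.span {\<psi>})" "vec.subspace (line_of p)"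
    using line_of[of p] vec.subspace_span by blast+
  then show "vec.span {\<psi>} \<subseteq> line_of p"
    by (intro vec.span_minimal) (use assms in blast)+
  show "vec.dim (line_of p) \<le> vec.dim (vec.span {\<psi>})"
    using line_of[of p] span_in_cp1[OF assms(2)] by simp
qed

lemma projector_eq_ketbra:
  assumes "\<psi> \<in> line_of p" "norm \<psi> = 1"
  shows "projector p = ketbra \<psi> \<psi>"
proof -
  have "ketbra \<phi> \<phi> = ketbra \<psi> \<psi>" if \<phi>: "\<phi> \<in> line_of p" "norm \<phi> = 1" for \<phi>
  proof -
    have "\<psi> \<noteq> 0" using assms(2) by auto
    then have "\<phi> \<in> vec.span {\<psi>}"
      using line_of_span[OF assms(1)] \<phi>(1) by blast
    then obtain c where c: "\<phi> = c *s \<psi>"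
      unfolding vec.span_singleton by blast
    then have "cmod c = 1"
      using norm_smult_vec[of c \<psi>] \<phi>(2) assms(2) by simp
    then have cc: "c * cnj c = 1"
      using complex_norm_square[of c] by simp
    have "c * a * cnj (c * b) = a * cnj b" for a b
    proof -
      have "c * a * cnj (c * b) = (c * cnj c) * (a * cnj b)" by simp
      then show ?thesis using cc by simp
    qed
    then show ?thesis
      unfolding c ketbra_def by (simp only: vector_smult_component)
  qed
  note eq = this
  show ?thesis
    unfolding projector_def
  proof (rule the_equality)
    show "\<forall>\<phi>\<in>line_of p. norm \<phi> = 1 \<longrightarrow> ketbra \<psi> \<psi> = ketbra \<phi> \<phi>"
      by (intro ballI impI) (simp only: eq)
    show "\<rho> = ketbra \<psi> \<psi>"
      if "\<forall>\<phi>\<in>line_of p. norm \<phi> = 1 \<longrightarrow> \<rho> = ketbra \<phi> \<phi>" for \<rho>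
      using bspec[OF that assms(1)] assms(2) by (rule mp)
  qed
qed

subsection \<open>The Fubini--Study metric\<close>

text \<open>Local smooth choices of a unit representative.\<close>

definition unit_lift :: "cp1 set \<Rightarrow> (cp1 \<Rightarrow> complex^2) \<Rightarrow> bool" where
  "unit_lift U \<psi> \<longleftrightarrow>
     open U \<and> (\<forall>q\<in>U. \<psi> q \<in> line_of q \<and> norm (\<psi> q) = 1) \<and>
     smooth_map (open_submanifold CP1 U) euclidean_manifold \<psi>"

text \<open>The line element $\langle d\psi|d\psi\rangle - |\langle\psi|d\psi\rangle|^2$ evaluated
  at a tangent vector; its value is the same for all local unit representatives.\<close>

definition ds2_FS :: "cp1 \<Rightarrow> ((cp1, complex) chart \<Rightarrow> complex) \<Rightarrow> real" where
  "ds2_FS p v =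
     (let \<psi> = (SOME \<psi>. \<exists>U. p \<in> U \<and> unit_lift U \<psi>);
          d\<psi> = euclidean_vector (differential CP1 euclidean_manifold \<psi> p v)
      in Re (braket d\<psi> d\<psi>) - (cmod (braket (\<psi> p) d\<psi>))\<^sup>2)"

section \<open>The truncated polynomial algebra\<close>

definition eps_cong :: "real poly \<Rightarrow> real poly \<Rightarrow> bool" where
  "eps_cong p q \<longleftrightarrow> [:0, 1:] ^ 3 dvd p - q"

lemma eps_cong_iff: "eps_cong p q \<longleftrightarrow> (\<forall>i<3. coeff p i = coeff q i)"
proof -
  have "[:0, 1:] ^ 3 = (monom 1 3 :: real poly)"
    by (simp add: monom_altdef)
  then show ?thesis
    unfolding eps_cong_def by (simp only: monom_1_dvd_iff') simp
qed

quotient_type trunc = "real poly" / eps_cong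
  by (rule equivpI) (auto simp: reflp_def symp_def transp_def eps_cong_iff)

lift_definition eps :: trunc is "[:0, 1:]" .

text \<open>The inner product is the one for which \<open>1\<close>, \<open>eps\<close>, \<open>eps\<^sup>2\<close> are orthonormal.\<close>

instantiation trunc :: comm_ring_1
begin
lift_definition zero_trunc :: trunc is 0 .
lift_definition one_trunc :: trunc is 1 .
lift_definition plus_trunc :: "trunc \<Rightarrow> trunc \<Rightarrow> trunc" is plus
  by (simp add: eps_cong_iff)
lift_definition minus_trunc :: "trunc \<Rightarrow> trunc \<Rightarrow> trunc" is minus
  by (simp add: eps_cong_iff)
lift_definition uminus_trunc :: "trunc \<Rightarrow> trunc" is uminus
  by (simp add: eps_cong_iff)
lift_definition times_trunc :: "trunc \<Rightarrow> trunc \<Rightarrow> trunc" is times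
  by (simp add: eps_cong_iff coeff_mult)
instance
  by standard (transfer, simp add: eps_cong_iff algebra_simps)+
end

lemma eps_cube: "eps ^ 3 = 0"
  by (simp add: power3_eq_cube, transfer, simp add: eps_cong_def power3_eq_cube)

instantiation trunc :: real_algebra_1
begin
lift_definition scaleR_trunc :: "real \<Rightarrow> trunc \<Rightarrow> trunc" is smult
  by (simp add: eps_cong_iff)
instance
  by standard (transfer, simp add: eps_cong_iff algebra_simps)+
end

instantiation trunc :: real_inner
begin
lift_definition inner_trunc :: "trunc \<Rightarrow> trunc \<Rightarrow> real" is
  "\<lambda>p q. \<Sum>i<3. coeff p i * coeff q i"
  by (simp add: eps_cong_iff)
definition norm_trunc :: "trunc \<Rightarrow> real" where
  "norm_trunc x = sqrt (inner x x)"
definition sgn_trunc :: "trunc \<Rightarrow> trunc" where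
  "sgn_trunc x = x /\<^sub>R norm x"
definition dist_trunc :: "trunc \<Rightarrow> trunc \<Rightarrow> real" where
  "dist_trunc x y = norm (x - y)"
definition uniformity_trunc :: "(trunc \<times> trunc) filter" where
  "uniformity_trunc = (INF e\<in>{0<..}. principal {(x, y). dist x y < e})"
definition open_trunc :: "trunc set \<Rightarrow> bool" where
  "open_trunc U \<longleftrightarrow> (\<forall>x\<in>U. eventually (\<lambda>(x', y). x' = x \<longrightarrow> y \<in> U) uniformity)"
instance
proof
  fix x y z :: trunc and r :: real
  show "inner x y = inner y x" by transfer (simp add: mult.commute)
  show "inner (x + y) z = inner x z + inner y z"
    by transfer (simp add: algebra_simps sum.distrib)
  show "inner (scaleR r x) y = r * inner x y"
    by transfer (simp add: sum_distrib_left mult.assoc)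
  show "0 \<le> inner x x" by transfer (simp add: sum_nonneg)
  show "inner x x = 0 \<longleftrightarrow> x = 0"
    by transfer (auto simp: eps_cong_iff sum_nonneg_eq_0_iff)
qed (rule sgn_trunc_def dist_trunc_def uniformity_trunc_def open_trunc_def norm_trunc_def)+
end

lemma inner_monomials:
  "inner (1::trunc) 1 = 1" "inner eps eps = 1" "inner (eps\<^sup>2) (eps\<^sup>2) = 1"
  "inner 1 eps = 0" "inner 1 (eps\<^sup>2) = 0" "inner eps (eps\<^sup>2) = 0"
  unfolding power2_eq_square
  by (transfer; simp add: eval_nat_numeral coeff_pCons)+

lemma inner_trunc_eq:
  "inner x y = inner x 1 * inner y 1 + inner x eps * inner y eps +
     inner x (eps\<^sup>2) * inner y (eps\<^sup>2)"
  unfolding power2_eq_square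
  by transfer (simp add: eval_nat_numeral coeff_pCons)

instantiation trunc :: euclidean_space
begin
definition Basis_trunc :: "trunc set" where
  "Basis_trunc = {1, eps, eps\<^sup>2}"
instance
proof
  fix x y u v :: trunc
  show "(Basis :: trunc set) \<noteq> {}" "finite (Basis :: trunc set)"
    by (auto simp: Basis_trunc_def)
  show "inner u v = (if u = v then 1 else 0)" if "u \<in> Basis" "v \<in> Basis"
    using that inner_monomials unfolding Basis_trunc_def
    by (auto simp: inner_commute)
  show "(\<forall>u\<in>Basis. inner x u = 0) \<longleftrightarrow> x = 0"
    using inner_trunc_eq[of x x] by (auto simp: Basis_trunc_def)
qed
end

section \<open>The density map\<close>

definition pauli_x :: "complex^2^2" where
  "pauli_x = vector [vector [0, 1], vector [1, 0]]"

definition pauli_y :: "complex^2^2" where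
  "pauli_y = vector [vector [0, - \<i>], vector [\<i>, 0]]"

definition pauli_z :: "complex^2^2" where
  "pauli_z = vector [vector [1, 0], vector [0, -1]]"

text \<open>The traces are real because all matrices involved are Hermitian.\<close>

definition density_map :: "complex^2^2 \<Rightarrow> trunc" where
  "density_map \<rho> =
     (let x = Re (trace (\<rho> ** pauli_x)); y = Re (trace (\<rho> ** pauli_y));
          z = Re (trace (\<rho> ** pauli_z))
      in of_real (1/2 + x) + of_real y * eps + of_real z * eps\<^sup>2)"

definition Psi :: "cp1 \<Rightarrow> trunc" where
  "Psi p = density_map (projector p)"

definition S2T :: "trunc set" where
  "S2T = {of_real (1/2 + x) + of_real y * eps + of_real z * eps\<^sup>2 | x y z :: real.
            x\<^sup>2 + y\<^sup>2 + z\<^sup>2 = 1}"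

definition S2T_manifold :: "(trunc, real^2) manifold" where
  "S2T_manifold = submanifold S2T"

text \<open>The Euclidean line element restricted to the tangent bundle of the sphere: tangent
  vectors of the sphere are pushed forward along the inclusion.\<close>

definition ds2_T :: "trunc \<Rightarrow> ((trunc, real^2) chart \<Rightarrow> real^2) \<Rightarrow> real" where
  "ds2_T q w =
     (let u = euclidean_vector (differential S2T_manifold euclidean_manifold (\<lambda>x. x) q w)
      in inner u u)"

end

theory Submission
  imports Defs
begin

text \<open>In the affine charts of the projective line the density map \<open>Psi\<close> is smooth, and on each
  chart domain it is inverted by a stereographic projection, which is smooth on an open set of the
  ambient space. An injective map with such local left inverses transports charts of its source
  to charts of its image; the smoothness of the coordinate changes, the embedding property and
  the diffeomorphism onto the image all follow from the chain rule.

  For the metric, let \<open>\<psi>\<close> be a local unit representative. Then \<open>Psi\<close> is the Hopf map of \<open>\<psi>\<close> up to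
  a constant, so its differential is the derivative of the Hopf map at \<open>\<psi>\<close> applied to \<open>d\<psi>\<close>.
  Its squared length is $4(|\psi|^2 |d\psi|^2 - |\langle\psi|d\psi\rangle|^2) +
  4\,(\mathrm{Re}\langle\psi|d\psi\rangle)^2$, and the last term vanishes because $|\psi| = 1$.\<close>

section \<open>Calculus of smooth maps\<close>

text \<open>Chart inverses and \<open>frechet_derivative\<close> are total functions fixed by
  choice, meaningful only on the chart image or where a derivative exists. Replacing one coordinate
  expression by another therefore needs an open set on which they agree, and many steps begin by
  proving a chart overlap open. Likewise \<open>ds2_FS\<close> and \<open>differential\<close>
  select a unit representative and a chart by \<open>SOME\<close>, so the metric identity has to be
  shown for every unit representative. The projective line carries a quotient topology; its
  Hausdorff property and second countability are inherited from the Euclidean side through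
  \<open>Psi\<close>. The sphere carries all its smooth charts, so smoothness against an arbitrary
  one rests on its local ambient extension. The factor 4 compares radii: in the given normalisation
  the projective line is a round sphere of radius 1/2, while the Bloch vector has length 1.\<close>

lemma higher_differentiable_on_cong:
  assumes "open S" "\<And>x. x \<in> S \<Longrightarrow> f x = g x"
  shows "higher_differentiable_on S f n \<longleftrightarrow> higher_differentiable_on S g n"
  using assms(2)
proof (induction n arbitrary: f g)
  case 0
  then show ?case by (simp cong: continuous_on_cong)
next
  case (Suc n)
  have D: "(f has_derivative D) (at x) \<longleftrightarrow> (g has_derivative D) (at x)" if "x \<in> S" for x D
    using has_derivative_transform_within_open[OF _ assms(1) that] Suc.prems by metis
  then have "frechet_derivative f (at x) = frechet_derivative g (at x)" if "x \<in> S" for x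
    using that by (simp add: frechet_derivative_def)
  then have "higher_differentiable_on S (\<lambda>x. frechet_derivative f (at x) v) n \<longleftrightarrow>
      higher_differentiable_on S (\<lambda>x. frechet_derivative g (at x) v) n" for v
    by (intro Suc.IH) simp
  with D show ?case by (simp add: differentiable_def)
qed

text \<open>Uniqueness of derivatives lets an explicit formula \<open>D\<close> stand for the chosen
  \<open>frechet_derivative\<close>. The closure rules exhibit such a formula and bound the order of
  its directional values.\<close>

lemma higher_differentiable_on_SucI:
  assumes "open S" "\<And>x. x \<in> S \<Longrightarrow> (f has_derivative D x) (at x)"
    and "\<And>v. higher_differentiable_on S (\<lambda>x. D x v) n"
  shows "higher_differentiable_on S f (Suc n)"
proof -
  have "frechet_derivative f (at x) v = D x v" if "x \<in> S" for x v
    using frechet_derivative_at[OF assms(2)[OF that]] by simp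
  with assms show ?thesis
    by (auto simp: differentiable_def cong: higher_differentiable_on_cong)
qed

text \<open>Level \<open>Suc n\<close> speaks only of derivatives, so the order of the function
  itself must be recovered; product rules need it for the undifferentiated factor.\<close>

lemma higher_differentiable_on_SucD:
  assumes "higher_differentiable_on S f (Suc n)"
  shows "higher_differentiable_on S f n"
  using assms
proof (induction n arbitrary: f)
  case 0
  then show ?case
    by (auto intro!: continuous_at_imp_continuous_on differentiable_imp_continuous_within)
next
  case (Suc n)
  then show ?case
    by (metis higher_differentiable_on.simps(2))
qed

lemma higher_differentiable_on_has_derivative:
  assumes "higher_differentiable_on S f (Suc n)" "x \<in> S"
  shows "(f has_derivative frechet_derivative f (at x)) (at x)"
  using assms by (simp add: frechet_derivative_works)

section \<open>Closure of finite-order differentiability under algebra and composition\<close>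

lemma higher_differentiable_on_const: "higher_differentiable_on S (\<lambda>x. c) n"
  by (induction n arbitrary: c) simp_all

lemma higher_differentiable_on_id: "higher_differentiable_on S (\<lambda>x. x) n"
  by (cases n) (simp_all add: higher_differentiable_on_const)

lemma higher_differentiable_on_linear:
  assumes "bounded_linear L" "open S" "higher_differentiable_on S f n"
  shows "higher_differentiable_on S (\<lambda>x. L (f x)) n"
  using assms(3)
proof (induction n arbitrary: f)
  case 0
  then show ?case
    using bounded_linear.continuous_on[OF assms(1)] by auto
next
  case (Suc n)
  show ?case
  proof (rule higher_differentiable_on_SucI[OF assms(2)])
    show "((\<lambda>x. L (f x)) has_derivative (\<lambda>v. L (frechet_derivative f (at x) v))) (at x)"
      if "x \<in> S" for x
      using bounded_linear.has_derivative[OF assms(1)]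
        higher_differentiable_on_has_derivative[OF Suc.prems that] by blast
    show "higher_differentiable_on S (\<lambda>x. L (frechet_derivative f (at x) v)) n" for v
      using Suc by simp
  qed
qed

lemma higher_differentiable_on_add:
  assumes "open S" "higher_differentiable_on S f n" "higher_differentiable_on S g n"
  shows "higher_differentiable_on S (\<lambda>x. f x + g x) n"
  using assms(2,3)
proof (induction n arbitrary: f g)
  case 0
  then show ?case by (simp add: continuous_on_add)
next
  case (Suc n)
  show ?case
  proof (rule higher_differentiable_on_SucI[OF assms(1)])
    show "((\<lambda>x. f x + g x) has_derivative
        (\<lambda>v. frechet_derivative f (at x) v + frechet_derivative g (at x) v)) (at x)"
      if "x \<in> S" for x
      using higher_differentiable_on_has_derivative that Suc.prems
      by (blast intro: has_derivative_add)
    show "higher_differentiable_on S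
        (\<lambda>x. frechet_derivative f (at x) v + frechet_derivative g (at x) v) n" for v
      using Suc by simp
  qed
qed

text \<open>The product rule gives two terms of the same shape, each with one factor differentiated;
  hence the induction varies both \<open>f\<close> and \<open>g\<close>. Scalar multiples, products
  and inner products are instances.\<close>

lemma higher_differentiable_on_bilinear:
  assumes "bounded_bilinear B" "open S"
    and "higher_differentiable_on S f n" "higher_differentiable_on S g n"
  shows "higher_differentiable_on S (\<lambda>x. B (f x) (g x)) n"
  using assms(3,4)
proof (induction n arbitrary: f g)
  case 0
  then show ?case
    using bounded_bilinear.continuous_on[OF assms(1)] by auto
next
  case (Suc n)
  show ?case
  proof (rule higher_differentiable_on_SucI[OF assms(2)])
    show "((\<lambda>x. B (f x) (g x)) has_derivative
        (\<lambda>v. B (f x) (frechet_derivative g (at x) v) +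
             B (frechet_derivative f (at x) v) (g x))) (at x)"
      if "x \<in> S" for x
      using bounded_bilinear.FDERIV[OF assms(1)
          higher_differentiable_on_has_derivative[OF Suc.prems(1) that]
          higher_differentiable_on_has_derivative[OF Suc.prems(2) that]] .
    show "higher_differentiable_on S
        (\<lambda>x. B (f x) (frechet_derivative g (at x) v) +
             B (frechet_derivative f (at x) v) (g x)) n" for v
      using Suc.prems higher_differentiable_on_SucD[OF Suc.prems(1)]
        higher_differentiable_on_SucD[OF Suc.prems(2)]
      by (intro higher_differentiable_on_add assms Suc.IH) simp_all
  qed
qed

lemma higher_differentiable_on_sum:
  assumes "open S" "\<And>i. i \<in> I \<Longrightarrow> higher_differentiable_on S (f i) n"
  shows "higher_differentiable_on S (\<lambda>x. \<Sum>i\<in>I. f i x) n"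
  using assms(2)
  by (induction I rule: infinite_finite_induct)
    (simp_all add: higher_differentiable_on_const higher_differentiable_on_add assms(1))

text \<open>The derivative contains the reciprocal again, but only to order \<open>n\<close>, which
  the induction hypothesis supplies.\<close>

lemma higher_differentiable_on_inverse:
  fixes f :: "'a::real_normed_vector \<Rightarrow> 'b::real_normed_field"
  assumes "open S" "higher_differentiable_on S f n" "\<And>x. x \<in> S \<Longrightarrow> f x \<noteq> 0"
  shows "higher_differentiable_on S (\<lambda>x. inverse (f x)) n"
  using assms(2)
proof (induction n)
  case 0
  then show ?case using assms(3) by (simp add: continuous_on_inverse)
next
  case (Suc n)
  have IH: "higher_differentiable_on S (\<lambda>x. inverse (f x)) n"
    using Suc.IH higher_differentiable_on_SucD[OF Suc.prems] by simp
  show ?case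
  proof (rule higher_differentiable_on_SucI[OF assms(1)])
    show "((\<lambda>x. inverse (f x)) has_derivative
        (\<lambda>v. - (inverse (f x) * frechet_derivative f (at x) v * inverse (f x)))) (at x)"
      if "x \<in> S" for x
      using higher_differentiable_on_has_derivative[OF Suc.prems that] assms(3)[OF that]
      by (rule Deriv.has_derivative_inverse[rotated])
    have "higher_differentiable_on S
        (\<lambda>x. inverse (f x) * frechet_derivative f (at x) v * inverse (f x)) n" for v
      using Suc.prems
      by (intro higher_differentiable_on_bilinear[OF bounded_bilinear_mult assms(1)] IH) simp
    then show "higher_differentiable_on S
        (\<lambda>x. - (inverse (f x) * frechet_derivative f (at x) v * inverse (f x))) n" for v
      by (rule higher_differentiable_on_linear[OF bounded_linear_minus[OF bounded_linear_ident] assms(1)])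
  qed
qed

lemma higher_differentiable_on_sqrt:
  fixes f :: "'a::real_normed_vector \<Rightarrow> real"
  assumes "open S" "higher_differentiable_on S f n" "\<And>x. x \<in> S \<Longrightarrow> f x > 0"
  shows "higher_differentiable_on S (\<lambda>x. sqrt (f x)) n"
  using assms(2)
proof (induction n)
  case 0
  then show ?case by (simp add: continuous_on_real_sqrt)
next
  case (Suc n)
  have IH: "higher_differentiable_on S (\<lambda>x. sqrt (f x)) n"
    using Suc.IH higher_differentiable_on_SucD[OF Suc.prems] by simp
  show ?case
  proof (rule higher_differentiable_on_SucI[OF assms(1)])
    show "((\<lambda>x. sqrt (f x)) has_derivative
        (\<lambda>v. frechet_derivative f (at x) v * (inverse (sqrt (f x)) / 2))) (at x)"
      if "x \<in> S" for x
      using has_derivative_real_sqrt[OF assms(3)[OF that]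
          higher_differentiable_on_has_derivative[OF Suc.prems that]] .
    show "higher_differentiable_on S
        (\<lambda>x. frechet_derivative f (at x) v * (inverse (sqrt (f x)) / 2)) n" for v
      using Suc.prems
      by (intro higher_differentiable_on_bilinear[OF bounded_bilinear_mult assms(1)]
          higher_differentiable_on_linear[OF bounded_linear_divide assms(1)]
          higher_differentiable_on_inverse IH)
        (use assms(1,3) in fastforce)+
  qed
qed

text \<open>Expanding the inner derivative in a basis turns the chain rule into a finite sum of
  products, so that the induction needs no smoothness of maps with values in linear maps.\<close>

lemma higher_differentiable_on_compose:
  fixes f :: "'b::euclidean_space \<Rightarrow> 'c::real_normed_vector"
    and g :: "'a::real_normed_vector \<Rightarrow> 'b"
  assumes "open S" "open T" "g ` S \<subseteq> T"
    and "higher_differentiable_on S g n" "higher_differentiable_on T f n"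
  shows "higher_differentiable_on S (\<lambda>x. f (g x)) n"
  using assms(4,5)
proof (induction n arbitrary: f)
  case 0
  then show ?case
    using continuous_on_compose2 assms(3) by auto
next
  case (Suc n)
  let ?D = "\<lambda>x v. \<Sum>b\<in>Basis.
    (frechet_derivative g (at x) v \<bullet> b) *\<^sub>R frechet_derivative f (at (g x)) b"
  show ?case
  proof (rule higher_differentiable_on_SucI[OF assms(1)])
    fix x assume x: "x \<in> S"
    have g: "(g has_derivative frechet_derivative g (at x)) (at x)"
      using higher_differentiable_on_has_derivative[OF Suc.prems(1) x] .
    have f: "(f has_derivative frechet_derivative f (at (g x))) (at (g x))"
      using higher_differentiable_on_has_derivative[OF Suc.prems(2)] x assms(3) by blast
    have lin: "linear (frechet_derivative f (at (g x)))"
      using f has_derivative_linear by blast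
    have "frechet_derivative f (at (g x)) = (\<lambda>w. \<Sum>b\<in>Basis. (w \<bullet> b) *\<^sub>R frechet_derivative f (at (g x)) b)"
    proof
      fix w
      show "frechet_derivative f (at (g x)) w =
          (\<Sum>b\<in>Basis. (w \<bullet> b) *\<^sub>R frechet_derivative f (at (g x)) b)"
        by (subst euclidean_representation[of w, symmetric])
          (simp only: linear_sum[OF lin] linear_cmul[OF lin])
    qed
    from fun_cong[OF this] show "((\<lambda>x. f (g x)) has_derivative ?D x) (at x)"
      by (rule has_derivative_eq_rhs[OF has_derivative_compose[OF g f] ext])
  next
    fix v
    show "higher_differentiable_on S (\<lambda>x. ?D x v) n"
      using Suc.prems higher_differentiable_on_SucD[OF Suc.prems(1)]
      by (intro higher_differentiable_on_sum assms(1) Suc.IH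
          higher_differentiable_on_bilinear[OF bounded_bilinear_scaleR]
          higher_differentiable_on_bilinear[OF bounded_bilinear_inner]
          higher_differentiable_on_const) simp_all
  qed
qed

section \<open>Infinitely smooth maps\<close>

lemma smooth_on_cong:
  assumes "open S" "\<And>x. x \<in> S \<Longrightarrow> f x = g x"
  shows "smooth_on S f \<longleftrightarrow> smooth_on S g"
  using higher_differentiable_on_cong[OF assms] by (simp add: smooth_on_def)

lemma smooth_on_const: "smooth_on S (\<lambda>x. c)"
  by (simp add: smooth_on_def higher_differentiable_on_const)

lemma smooth_on_id: "smooth_on S (\<lambda>x. x)"
  by (simp add: smooth_on_def higher_differentiable_on_id)

lemma smooth_on_linear:
  "bounded_linear L \<Longrightarrow> open S \<Longrightarrow> smooth_on S f \<Longrightarrow> smooth_on S (\<lambda>x. L (f x))"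
  by (simp add: smooth_on_def higher_differentiable_on_linear)

lemma smooth_on_add:
  "open S \<Longrightarrow> smooth_on S f \<Longrightarrow> smooth_on S g \<Longrightarrow> smooth_on S (\<lambda>x. f x + g x)"
  by (simp add: smooth_on_def higher_differentiable_on_add)

lemma smooth_on_minus:
  "open S \<Longrightarrow> smooth_on S f \<Longrightarrow> smooth_on S (\<lambda>x. - f x)"
  by (rule smooth_on_linear[OF bounded_linear_minus[OF bounded_linear_ident]])

lemma smooth_on_diff:
  "open S \<Longrightarrow> smooth_on S f \<Longrightarrow> smooth_on S g \<Longrightarrow> smooth_on S (\<lambda>x. f x - g x)"
  using smooth_on_add[of S f "\<lambda>x. - g x"] by (simp add: smooth_on_minus)

lemma smooth_on_scaleR:
  "open S \<Longrightarrow> smooth_on S f \<Longrightarrow> smooth_on S g \<Longrightarrow> smooth_on S (\<lambda>x. f x *\<^sub>R g x)"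
  by (simp add: smooth_on_def higher_differentiable_on_bilinear[OF bounded_bilinear_scaleR])

lemma smooth_on_mult:
  fixes f g :: "'a::real_normed_vector \<Rightarrow> 'b::real_normed_algebra"
  shows "open S \<Longrightarrow> smooth_on S f \<Longrightarrow> smooth_on S g \<Longrightarrow> smooth_on S (\<lambda>x. f x * g x)"
  by (simp add: smooth_on_def higher_differentiable_on_bilinear[OF bounded_bilinear_mult])

lemma smooth_on_inner:
  "open S \<Longrightarrow> smooth_on S f \<Longrightarrow> smooth_on S g \<Longrightarrow> smooth_on S (\<lambda>x. f x \<bullet> g x)"
  by (simp add: smooth_on_def higher_differentiable_on_bilinear[OF bounded_bilinear_inner])

lemma smooth_on_inverse:
  fixes f :: "'a::real_normed_vector \<Rightarrow> 'b::real_normed_field"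
  shows "open S \<Longrightarrow> smooth_on S f \<Longrightarrow> (\<And>x. x \<in> S \<Longrightarrow> f x \<noteq> 0) \<Longrightarrow>
    smooth_on S (\<lambda>x. inverse (f x))"
  by (simp add: smooth_on_def higher_differentiable_on_inverse)

lemma smooth_on_sqrt:
  fixes f :: "'a::real_normed_vector \<Rightarrow> real"
  shows "open S \<Longrightarrow> smooth_on S f \<Longrightarrow> (\<And>x. x \<in> S \<Longrightarrow> f x > 0) \<Longrightarrow>
    smooth_on S (\<lambda>x. sqrt (f x))"
  by (simp add: smooth_on_def higher_differentiable_on_sqrt)

lemma smooth_on_compose:
  fixes f :: "'b::euclidean_space \<Rightarrow> 'c::real_normed_vector"
    and g :: "'a::real_normed_vector \<Rightarrow> 'b"
  assumes "open S" "open T" "g ` S \<subseteq> T" "smooth_on S g" "smooth_on T f"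
  shows "smooth_on S (\<lambda>x. f (g x))"
  using assms by (simp add: smooth_on_def higher_differentiable_on_compose[where T = T])

lemma smooth_on_imp_continuous_on: "smooth_on S f \<Longrightarrow> continuous_on S f"
  using higher_differentiable_on.simps(1) unfolding smooth_on_def by blast

lemma smooth_on_has_derivative:
  assumes "smooth_on S f" "x \<in> S"
  shows "(f has_derivative frechet_derivative f (at x)) (at x)"
proof (rule higher_differentiable_on_has_derivative[OF _ assms(2)])
  show "higher_differentiable_on S f (Suc 0)"
    using assms(1) unfolding smooth_on_def by blast
qed

lemma smooth_on_subset:
  assumes "smooth_on S f" "T \<subseteq> S"
  shows "smooth_on T f"
proof -
  have "higher_differentiable_on T f n" if "higher_differentiable_on S f n" for n
    using that
    by (induction n arbitrary: f) (use assms(2) in \<open>auto intro: continuous_on_subset\<close>)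
  then show ?thesis using assms(1) by (simp add: smooth_on_def)
qed

lemma smooth_on_local:
  assumes "\<And>x. x \<in> S \<Longrightarrow> \<exists>U. open U \<and> x \<in> U \<and> smooth_on U f"
  shows "smooth_on S f"
proof -
  have "higher_differentiable_on S f n"
    if "\<And>x. x \<in> S \<Longrightarrow> \<exists>U. open U \<and> x \<in> U \<and> higher_differentiable_on U f n" for n
    using that
  proof (induction n arbitrary: f)
    case 0
    then have "isCont f x" if "x \<in> S" for x
      using that continuous_on_eq_continuous_at by fastforce
    then show ?case
      by (simp add: continuous_at_imp_continuous_on)
  next
    case (Suc n)
    show ?case
      unfolding higher_differentiable_on.simps
      using Suc.prems by (intro conjI allI ballI Suc.IH) (metis higher_differentiable_on.simps(2))+
  qed
  with assms show ?thesis
    unfolding smooth_on_def by metis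
qed

section \<open>Manifolds parametrising a subset of a Euclidean space\<close>

lemma continuous_on_openin_local:
  assumes "\<And>x. x \<in> S \<Longrightarrow> \<exists>U. openin (top_of_set S) U \<and> x \<in> U \<and> continuous_on U f"
  shows "continuous_on S f"
  unfolding continuous_on_def
proof
  fix x assume "x \<in> S"
  then obtain U T where U: "open T" "U = S \<inter> T" "x \<in> U" "continuous_on U f"
    using assms[OF \<open>x \<in> S\<close>] unfolding openin_open by blast
  then have "at x within U = at x within S"
    by (intro at_within_nhd[of x T]) auto
  with U show "(f \<longlongrightarrow> f x) (at x within S)"
    unfolding continuous_on_def by metis
qed

text \<open>Both sides are choices from the same collection of derivatives, so they coincide even
  where neither function is differentiable.\<close>

lemma frechet_derivative_transform_within_open:
  assumes "open S" "x \<in> S" "\<And>y. y \<in> S \<Longrightarrow> f y = g y"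
  shows "frechet_derivative f (at x) = frechet_derivative g (at x)"
proof -
  have "(f has_derivative D) (at x) \<longleftrightarrow> (g has_derivative D) (at x)" for D
    using has_derivative_transform_within_open[OF _ assms(1,2)] assms(3) by metis
  then show ?thesis by (simp add: frechet_derivative_def)
qed

text \<open>The chain rule as charts require it: \<open>h\<close> is the composite only near
  \<open>x\<close>, since a chart and its inverse cancel only on the chart domain.\<close>

lemma frechet_derivative_compose_at:
  assumes "(f has_derivative f') (at x)" "(g has_derivative g') (at (f x))"
    and "open S" "x \<in> S" "\<And>y. y \<in> S \<Longrightarrow> h y = g (f y)"
  shows "frechet_derivative h (at x) v = g' (f' v)"
proof -
  have "((\<lambda>y. g (f y)) has_derivative (\<lambda>v. g' (f' v))) (at x)"
    using has_derivative_compose[OF assms(1,2)] .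
  then have "frechet_derivative (\<lambda>y. g (f y)) (at x) = (\<lambda>v. g' (f' v))"
    by (rule frechet_derivative_at[symmetric])
  then show ?thesis
    using frechet_derivative_transform_within_open[of S x h "\<lambda>y. g (f y)"] assms by simp
qed

text \<open>As a preimage under the chart inverse, the coordinate image of an overlap is open by
  continuity.\<close>

lemma image_chart_Int:
  assumes "inj_on (snd c) (fst c)"
  shows "snd c ` (fst c \<inter> X) = snd c ` fst c \<inter> chart_inv c -` X"
  using assms by (auto simp: inv_into_f_f)

text \<open>A Euclidean target has the identity as its single chart, so the differential is an
  ordinary derivative in the selected source chart.\<close>

lemma euclidean_vector_differential:
  "euclidean_vector (differential M euclidean_manifold f p v) =
     (let c = SOME c. c \<in> charts_at M p
      in frechet_derivative (f \<circ> chart_inv c) (at (snd c p)) (v c))"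
  by (simp add: euclidean_vector_def differential_def charts_at_def euclidean_manifold_def
      Let_def comp_def)

lemma smooth_manifold_euclidean_manifold:
  "smooth_manifold (euclidean_manifold :: ('a::euclidean_space, 'a) manifold)"
proof -
  have inv: "inv_into UNIV (\<lambda>x::'a. x) = (\<lambda>x. x)"
    by (simp add: inv_f_f fun_eq_iff)
  have "second_countable (euclidean :: 'a topology)"
  proof -
    obtain B :: "'a set set" where B: "countable B" "\<And>C. C \<in> B \<Longrightarrow> open C"
      "\<And>U. open U \<Longrightarrow> \<exists>K. K \<subseteq> B \<and> U = \<Union>K"
      using univ_second_countable by blast
    then have "\<exists>V\<in>B. x \<in> V \<and> V \<subseteq> U" if "open U" "x \<in> U" for U x
      using that B(3)[OF that(1)] by blast
    with B(1,2) show ?thesis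
      unfolding second_countable_def by (intro exI[of _ B]) simp
  qed
  then show ?thesis
    unfolding smooth_manifold_def euclidean_manifold_def
    by (simp add: Hausdorff_space_euclidean inv comp_def smooth_on_id homeomorphism_def
        continuous_on_id)
qed

lemma second_countable_top_of_set:
  "second_countable (top_of_set (S :: 'a::euclidean_space set))"
  using smooth_manifold_euclidean_manifold[where 'a = 'a]
  by (simp add: smooth_manifold_def euclidean_manifold_def second_countable_subtopology)

section \<open>Charts of a subset of a Euclidean space\<close>

lemma submanifold_chartD:
  assumes "c \<in> charts (submanifold S)"
  shows "openin (top_of_set S) (fst c)" "inj_on (snd c) (fst c)" "open (snd c ` fst c)"
    "smooth_on (snd c ` fst c) (chart_inv c)"
    "\<And>x. x \<in> fst c \<Longrightarrow> \<exists>W g. open W \<and> x \<in> W \<and> smooth_on W g \<and> (\<forall>y\<in>W \<inter> fst c. g y = snd c y)"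
  using assms by (auto simp: submanifold_def)

text \<open>A submanifold chart need not be controlled on any ambient open set. Replacing it near
  each point by its smooth ambient extension makes the ordinary chain rule applicable.\<close>

lemma smooth_on_submanifold_chart:
  assumes "c \<in> charts (submanifold S)" "open V" "smooth_on V g" "g ` V \<subseteq> fst c"
  shows "smooth_on V (\<lambda>x. snd c (g x))"
proof (rule smooth_on_local)
  fix x assume "x \<in> V"
  then obtain W h where W: "open W" "g x \<in> W" "smooth_on W h" "\<And>y. y \<in> W \<inter> fst c \<Longrightarrow> h y = snd c y"
    using submanifold_chartD(5)[OF assms(1)] assms(4) by (metis image_subset_iff)
  let ?U = "V \<inter> g -` W"
  have "open ?U"
    using smooth_on_imp_continuous_on[OF assms(3)] assms(2) W(1)
    by (rule continuous_open_preimage)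
  moreover have "smooth_on ?U (\<lambda>x. h (g x))"
    by (rule smooth_on_compose[OF \<open>open ?U\<close> W(1) _ smooth_on_subset[OF assms(3)] W(3)]) auto
  then have "smooth_on ?U (\<lambda>x. snd c (g x))"
    by (rule iffD1[OF smooth_on_cong[OF \<open>open ?U\<close>], rotated]) (use W(4) assms(4) in auto)
  ultimately show "\<exists>U. open U \<and> x \<in> U \<and> smooth_on U (\<lambda>x. snd c (g x))"
    using \<open>x \<in> V\<close> W(2) by blast
qed

lemma homeomorphism_submanifold_chart:
  assumes "c \<in> charts (submanifold S)"
  shows "homeomorphism (fst c) (snd c ` fst c) (snd c) (chart_inv c)"
proof -
  note c = submanifold_chartD[OF assms]
  have "continuous_on (fst c) (snd c)"
  proof (rule continuous_on_openin_local)
    fix x assume "x \<in> fst c"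
    then obtain W g where W: "open W" "x \<in> W" "smooth_on W g" "\<And>y. y \<in> W \<inter> fst c \<Longrightarrow> g y = snd c y"
      using c(5) by metis
    have "continuous_on (W \<inter> fst c) g"
      by (rule continuous_on_subset[OF smooth_on_imp_continuous_on[OF W(3)] Int_lower1])
    then have "continuous_on (W \<inter> fst c) (snd c)"
      by (rule continuous_on_eq) (rule W(4))
    then show "\<exists>U. openin (top_of_set (fst c)) U \<and> x \<in> U \<and> continuous_on U (snd c)"
      using W(1,2) \<open>x \<in> fst c\<close> by (metis Int_commute Int_iff openin_open_Int)
  qed
  with c(2) smooth_on_imp_continuous_on[OF c(4)] show ?thesis
    by (auto simp: homeomorphism_def inv_into_f_f)
qed

text \<open>Only the covering depends on \<open>S\<close>: the definition of the charts makes them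
  homeomorphisms, and a coordinate change is a smooth chart inverse followed by a chart.\<close>

lemma smooth_manifold_submanifold:
  assumes "(\<Union>c\<in>charts (submanifold S :: ('a::euclidean_space, 'e::euclidean_space) manifold). fst c) = S"
  shows "smooth_manifold (submanifold S :: ('a, 'e) manifold)"
  unfolding smooth_manifold_def
proof (intro conjI ballI)
  let ?N = "submanifold S :: ('a, 'e) manifold"
  have pts: "points ?N = S"
    by (simp add: submanifold_def)
  show "Hausdorff_space (top_of_set (points ?N))"
    by (simp add: Hausdorff_space_euclidean Hausdorff_space_subtopology)
  show "second_countable (top_of_set (points ?N))"
    by (rule second_countable_top_of_set)
  show "(\<Union>c\<in>charts ?N. fst c) = points ?N"
    using assms pts by simp
  fix c assume c: "c \<in> charts ?N"
  note cD = submanifold_chartD[OF c]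
  show "openin (top_of_set (points ?N)) (fst c)" "open (snd c ` fst c)"
    using cD pts by simp_all
  show "homeomorphism (fst c) (snd c ` fst c) (snd c) (chart_inv c)"
    using homeomorphism_submanifold_chart[OF c] .
  fix d assume d: "d \<in> charts ?N"
  obtain T where T: "open T" "fst d = S \<inter> T"
    using submanifold_chartD(1)[OF d] by (auto simp: openin_open)
  let ?V = "snd c ` (fst c \<inter> fst d)"
  have "fst c \<subseteq> S"
    using cD(1) openin_imp_subset by blast
  then have "?V = snd c ` (fst c \<inter> T)"
    using T(2) by auto
  also have "\<dots> = snd c ` fst c \<inter> chart_inv c -` T"
    by (rule image_chart_Int[OF cD(2)])
  also have "open \<dots>"
    by (rule continuous_open_preimage[OF smooth_on_imp_continuous_on[OF cD(4)] cD(3) T(1)])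
  finally have "open ?V" .
  then show "smooth_on ?V (snd d \<circ> chart_inv c)"
    unfolding comp_def
    by (rule smooth_on_submanifold_chart[OF d _ smooth_on_subset[OF cD(4)]])
      (use cD(2) in \<open>auto simp: inv_into_f_f\<close>)
qed

text \<open>For each chart, one smooth \<open>g\<close> on an ambient open set reads off the
  coordinates from the value of \<open>f\<close>. This gives the immersion property, the continuity
  of the inverse and the smoothness of coordinate changes. Hausdorffness, second countability and
  compatibility of charts are thus conclusions, not assumptions.\<close>

locale smooth_parametrisation =
  fixes M :: "('a::topological_space, 'e::euclidean_space) manifold"
    and S :: "'b::euclidean_space set" and f :: "'a \<Rightarrow> 'b"
  assumes cover: "(\<Union>c\<in>charts M. fst c) = points M"
    and chart_openin: "c \<in> charts M \<Longrightarrow> openin (top_of_set (points M)) (fst c)"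
    and chart_open: "c \<in> charts M \<Longrightarrow> open (snd c ` fst c)"
    and chart_homeomorphism:
      "c \<in> charts M \<Longrightarrow> homeomorphism (fst c) (snd c ` fst c) (snd c) (chart_inv c)"
    and bij: "bij_betw f (points M) S"
    and smooth_chart: "c \<in> charts M \<Longrightarrow> smooth_on (snd c ` fst c) (\<lambda>z. f (chart_inv c z))"
    and left_inverse: "c \<in> charts M \<Longrightarrow>
      \<exists>W g. open W \<and> f ` fst c = S \<inter> W \<and> smooth_on W g \<and> (\<forall>q\<in>fst c. g (f q) = snd c q)"
begin

lemma chart_inj: "c \<in> charts M \<Longrightarrow> inj_on (snd c) (fst c)"
  using chart_homeomorphism by (metis homeomorphism_def inj_on_inverseI)

lemma chart_subset: "c \<in> charts M \<Longrightarrow> fst c \<subseteq> points M"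
  using cover by blast

lemma inj: "inj_on f (points M)"
  using bij bij_betw_imp_inj_on by blast

lemma image_points: "f ` points M = S"
  using bij bij_betw_imp_surj_on by blast

lemma continuous: "continuous_on (points M) f"
proof (rule continuous_on_openin_local)
  fix x assume "x \<in> points M"
  then obtain c where c: "c \<in> charts M" "x \<in> fst c"
    using cover by blast
  have "continuous_on (fst c) (snd c)"
    using chart_homeomorphism[OF c(1)] by (simp add: homeomorphism_def)
  then have "continuous_on (fst c) (\<lambda>q. f (chart_inv c (snd c q)))"
    by (rule continuous_on_compose2[OF smooth_on_imp_continuous_on[OF smooth_chart[OF c(1)]]]) simp
  then have "continuous_on (fst c) f"
    by (rule iffD1[OF continuous_on_cong[OF refl], rotated])
      (simp add: inv_into_f_f chart_inj[OF c(1)])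
  with c chart_openin show "\<exists>U. openin (top_of_set (points M)) U \<and> x \<in> U \<and> continuous_on U f"
    by blast
qed

text \<open>Injectivity of \<open>f\<close> turns the equation of images into a membership test: the
  chart domain is the preimage of \<open>W\<close>.\<close>

lemma chart_left_inverse:
  assumes "c \<in> charts M"
  obtains W g where "open W" "smooth_on W g" "\<And>q. q \<in> points M \<Longrightarrow> f q \<in> W \<longleftrightarrow> q \<in> fst c"
    "\<And>q. q \<in> fst c \<Longrightarrow> g (f q) = snd c q"
proof -
  obtain W g where W: "open W" "f ` fst c = S \<inter> W" "smooth_on W g" "\<forall>q\<in>fst c. g (f q) = snd c q"
    using left_inverse[OF assms] by blast
  have "f q \<in> W \<longleftrightarrow> q \<in> fst c" if "q \<in> points M" for q
  proof -
    have "f q \<in> W \<longleftrightarrow> f q \<in> f ` fst c"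
      using W(2) image_points that by auto
    then show ?thesis
      using inj_on_image_mem_iff[OF inj that chart_subset[OF assms]] by simp
  qed
  with W that show ?thesis by blast
qed

abbreviation f_inv :: "'b \<Rightarrow> 'a" where
  "f_inv \<equiv> inv_into (points M) f"

lemma f_inv: "y \<in> S \<Longrightarrow> f_inv y \<in> points M \<and> f (f_inv y) = y"
  using image_points by (metis inv_into_into f_inv_into_f)

lemma continuous_f_inv: "continuous_on S f_inv"
proof (rule continuous_on_openin_local)
  fix y assume y: "y \<in> S"
  then obtain c where c: "c \<in> charts M" "f_inv y \<in> fst c"
    using cover f_inv by blast
  obtain W g where W: "open W" "smooth_on W g" "\<And>q. q \<in> points M \<Longrightarrow> f q \<in> W \<longleftrightarrow> q \<in> fst c"
    "\<And>q. q \<in> fst c \<Longrightarrow> g (f q) = snd c q"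
    using chart_left_inverse[OF c(1)] by metis
  have mem: "f_inv w \<in> fst c" if "w \<in> S \<inter> W" for w
    using W(3) f_inv that by (metis IntD1 IntD2)
  have g: "g w = snd c (f_inv w)" if "w \<in> S \<inter> W" for w
    using W(4)[OF mem[OF that]] f_inv that by simp
  have "continuous_on (snd c ` fst c) (chart_inv c)"
    using chart_homeomorphism[OF c(1)] by (simp add: homeomorphism_def)
  moreover have "continuous_on (S \<inter> W) g"
    using smooth_on_imp_continuous_on[OF W(2)] by (rule continuous_on_subset) simp
  ultimately have "continuous_on (S \<inter> W) (\<lambda>w. chart_inv c (g w))"
    by (rule continuous_on_compose2) (use g mem in auto)
  then have "continuous_on (S \<inter> W) f_inv"
    by (rule iffD1[OF continuous_on_cong[OF refl], rotated])
      (simp add: g mem inv_into_f_f chart_inj[OF c(1)])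
  moreover have "y \<in> W"
    using W(3) c(2) f_inv[OF y] by metis
  ultimately show "\<exists>U. openin (top_of_set S) U \<and> y \<in> U \<and> continuous_on U f_inv"
    using y W(1) by (metis IntI openin_open_Int)
qed

lemma homeomorphism: "homeomorphism (points M) S f f_inv"
  using continuous continuous_f_inv image_points f_inv inj
  by (intro homeomorphismI) (auto simp: inv_into_f_f)

lemma open_chart_overlap:
  assumes "c \<in> charts M" "open T"
  shows "open (snd c ` (fst c \<inter> f -` T))"
proof -
  have "snd c ` (fst c \<inter> f -` T) = snd c ` fst c \<inter> (\<lambda>z. f (chart_inv c z)) -` T"
    unfolding image_chart_Int[OF chart_inj[OF assms(1)]] by auto
  then show ?thesis
    using continuous_open_preimage[OF smooth_on_imp_continuous_on[OF smooth_chart] chart_open]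
      assms by simp
qed

text \<open>Points are separated because \<open>f\<close> is a continuous injection into a Hausdorff
  space, and a countable base comes back along the homeomorphism with \<open>S\<close>. A coordinate
  change from \<open>c\<close> to \<open>d\<close> is the left inverse of \<open>d\<close> applied
  to \<open>f\<close> after the inverse of \<open>c\<close>.\<close>

lemma smooth_manifold: "smooth_manifold M"
  unfolding smooth_manifold_def
proof (intro conjI ballI cover chart_openin chart_open chart_homeomorphism)
  have "continuous_map (top_of_set (points M)) euclidean f"
    using continuous by simp
  then show "Hausdorff_space (top_of_set (points M))"
    by (rule Hausdorff_space_injective_preimage[OF Hausdorff_space_euclidean]) (simp add: inj)
  have "top_of_set (points M) homeomorphic_space top_of_set S"
    using homeomorphism unfolding homeomorphic_space_def homeomorphic_maps_def homeomorphism_def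
    by (intro exI[of _ f] exI[of _ f_inv]) auto
  then show "second_countable (top_of_set (points M))"
    using homeomorphic_space_second_countability second_countable_top_of_set by blast
  fix c d assume c: "c \<in> charts M" and d: "d \<in> charts M"
  obtain W g where W: "open W" "smooth_on W g" "\<And>q. q \<in> points M \<Longrightarrow> f q \<in> W \<longleftrightarrow> q \<in> fst d"
    "\<And>q. q \<in> fst d \<Longrightarrow> g (f q) = snd d q"
    using chart_left_inverse[OF d] by metis
  have "fst c \<inter> fst d = fst c \<inter> f -` W"
    using W(3) chart_subset[OF c] by auto
  then have op: "open (snd c ` (fst c \<inter> fst d))"
    using open_chart_overlap[OF c W(1)] by simp
  have mem: "chart_inv c z \<in> fst c \<inter> fst d" if "z \<in> snd c ` (fst c \<inter> fst d)" for z
    using that chart_inj[OF c] by (auto simp: inv_into_f_f)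
  have "smooth_on (snd c ` (fst c \<inter> fst d)) (\<lambda>z. g (f (chart_inv c z)))"
    by (rule smooth_on_compose[OF op W(1) _ smooth_on_subset[OF smooth_chart[OF c]] W(2)])
      (use mem W(3) chart_subset[OF c] in auto)
  then show "smooth_on (snd c ` (fst c \<inter> fst d)) (snd d \<circ> chart_inv c)"
    by (rule iffD1[OF smooth_on_cong[OF op], rotated]) (use mem W(4) in auto)
qed

lemma smooth_map_euclidean: "smooth_map M euclidean_manifold f"
  using continuous smooth_chart
  by (simp add: smooth_map_def euclidean_manifold_def comp_def)

lemma someI_charts_at:
  assumes "p \<in> points M"
  shows "(SOME c. c \<in> charts_at M p) \<in> charts M" "p \<in> fst (SOME c. c \<in> charts_at M p)"
proof -
  have "\<exists>c. c \<in> charts_at M p"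
    using assms cover unfolding charts_at_def by blast
  then have "(SOME c. c \<in> charts_at M p) \<in> charts_at M p"
    by (rule someI_ex)
  then show "(SOME c. c \<in> charts_at M p) \<in> charts M" "p \<in> fst (SOME c. c \<in> charts_at M p)"
    by (simp_all add: charts_at_def)
qed

lemma inj_differential:
  assumes p: "p \<in> points M"
  shows "inj_on (differential M euclidean_manifold f p) (tangent_space M p)"
proof (rule inj_onI)
  fix v w assume v: "v \<in> tangent_space M p" and w: "w \<in> tangent_space M p"
    and eq: "differential M euclidean_manifold f p v = differential M euclidean_manifold f p w"
  define c where "c = (SOME c. c \<in> charts_at M p)"
  have c: "c \<in> charts M" "p \<in> fst c"
    using someI_charts_at[OF p] by (simp_all add: c_def)
  obtain W g where W: "open W" "smooth_on W g" "\<And>q. q \<in> points M \<Longrightarrow> f q \<in> W \<longleftrightarrow> q \<in> fst c"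
    "\<And>q. q \<in> fst c \<Longrightarrow> g (f q) = snd c q"
    using chart_left_inverse[OF c(1)] by metis
  have pz: "snd c p \<in> snd c ` fst c" "chart_inv c (snd c p) = p"
    using c chart_inj by (auto simp: inv_into_f_f)
  let ?f = "frechet_derivative (\<lambda>z. f (chart_inv c z)) (at (snd c p))"
  let ?g = "frechet_derivative g (at (f p))"
  \<comment> \<open>Differentiating \<open>z = g (f (chart_inv c z))\<close> makes the derivative of
    \<open>g\<close> a left inverse of that of \<open>f\<close>.\<close>
  have D: "?g (?f u) = u" for u
  proof -
    have "frechet_derivative (\<lambda>z. z) (at (snd c p)) u = ?g (?f u)"
    proof (rule frechet_derivative_compose_at[OF smooth_on_has_derivative[OF smooth_chart[OF c(1)] pz(1)]
          _ chart_open[OF c(1)] pz(1)])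
      show "(g has_derivative ?g) (at (f (chart_inv c (snd c p))))"
        using smooth_on_has_derivative[OF W(2)] W(3)[OF p] c(2) pz(2) by simp
      show "z = g (f (chart_inv c z))" if "z \<in> snd c ` fst c" for z
        using that W(4) by (auto simp: inv_into_f_f chart_inj[OF c(1)])
    qed
    then show ?thesis by simp
  qed
  have "?f (v c) = ?f (w c)"
    using arg_cong[OF eq, of euclidean_vector]
    by (simp add: euclidean_vector_differential c_def[symmetric] comp_def)
  then have vw: "v c = w c"
    using D by metis
  have c_at: "c \<in> charts_at M p"
    using c by (simp add: charts_at_def)
  \<comment> \<open>A tangent vector is determined by its component in the one chart
    \<open>c\<close>: Jacobians give the components in the other charts at \<open>p\<close>, and
    elsewhere the value is the default 0.\<close>
  have coord: "u d = (if d \<in> charts_at M p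
      then frechet_derivative (snd d \<circ> chart_inv c) (at (snd c p)) (u c) else 0)"
    if "u \<in> tangent_space M p" for u d
  proof (cases "d \<in> charts_at M p")
    case True
    with that c_at show ?thesis
      unfolding tangent_space_def if_P[OF True] by blast
  next
    case False
    with that show ?thesis
      unfolding tangent_space_def if_not_P[OF False] by blast
  qed
  show "v = w"
  proof
    fix d
    show "v d = w d"
      using coord[OF v, of d] coord[OF w, of d] unfolding vw by (simp only:)
  qed
qed

theorem smooth_embedding: "smooth_embedding M euclidean_manifold f"
  unfolding smooth_embedding_def
  using smooth_manifold smooth_manifold_euclidean_manifold smooth_map_euclidean inj_differential
    homeomorphism image_points by simp

end

text \<open>The image may be modelled on a different vector space than the source, and
  \<open>L\<close> identifies the two; in the application complex coordinates become pairs of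
  reals.\<close>

locale smooth_parametrisation_iso = smooth_parametrisation M S f
  for M :: "('a::topological_space, 'e::euclidean_space) manifold"
    and S :: "'b::euclidean_space set" and f :: "'a \<Rightarrow> 'b" +
  fixes L :: "'e \<Rightarrow> 'g::euclidean_space" and L' :: "'g \<Rightarrow> 'e"
  assumes linear: "bounded_linear L" "bounded_linear L'"
    and L_inverse: "L' (L z) = z" "L (L' w) = w"
begin

abbreviation N :: "('b, 'g) manifold" where
  "N \<equiv> submanifold S"

lemma points_N: "points N = S"
  by (simp add: submanifold_def)

text \<open>On the image of the chart domain the pushed-forward chart equals \<open>L\<close> after
  \<open>g\<close>, which is the required ambient extension; its inverse is \<open>f\<close> after
  \<open>chart_inv c\<close> after \<open>L'\<close>.\<close>

lemma transported_chart:
  assumes c: "c \<in> charts M"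
  shows "(f ` fst c, \<lambda>y. L (snd c (f_inv y))) \<in> charts N"
proof -
  obtain W g where W: "open W" "f ` fst c = S \<inter> W" "smooth_on W g" "\<And>q. q \<in> fst c \<Longrightarrow> g (f q) = snd c q"
    using left_inverse[OF c] by metis
  define h where "h = (\<lambda>y. L (snd c (f_inv y)))"
  have finv: "f_inv (f q) = q" if "q \<in> fst c" for q
    using that inj chart_subset[OF c] by (auto simp: inv_into_f_f)
  have h: "h (f q) = L (snd c q)" if "q \<in> fst c" for q
    using finv[OF that] by (simp add: h_def)
  \<comment> \<open>A preimage under the continuous \<open>L'\<close>, hence open.\<close>
  have img: "h ` f ` fst c = L' -` (snd c ` fst c)"
  proof
    show "h ` f ` fst c \<subseteq> L' -` (snd c ` fst c)"
      by (auto simp: h L_inverse)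
    show "L' -` (snd c ` fst c) \<subseteq> h ` f ` fst c"
    proof
      fix w assume "w \<in> L' -` (snd c ` fst c)"
      then obtain q where "q \<in> fst c" "L' w = snd c q" by auto
      then have "w = h (f q)" using h L_inverse by metis
      then show "w \<in> h ` f ` fst c" using \<open>q \<in> fst c\<close> by blast
    qed
  qed
  have inj_h: "inj_on h (f ` fst c)"
  proof (rule inj_onI, clarify)
    fix q r assume q: "q \<in> fst c" and r: "r \<in> fst c" and "h (f q) = h (f r)"
    then have "snd c q = snd c r"
      using h L_inverse by metis
    then show "f q = f r"
      using q r chart_inj[OF c] by (auto dest: inj_onD)
  qed
  have "continuous_on UNIV L'"
    using linear(2) linear_continuous_on by blast
  then have op: "open (h ` f ` fst c)"
    unfolding img using open_vimage[OF chart_open[OF c]] by blast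
  have "smooth_on (h ` f ` fst c) (\<lambda>w. f (chart_inv c (L' w)))"
    by (rule smooth_on_compose[OF op chart_open[OF c] _ smooth_on_linear[OF linear(2) op smooth_on_id]
          smooth_chart[OF c]]) (auto simp: img)
  moreover have "f (chart_inv c (L' w)) = inv_into (f ` fst c) h w" if w: "w \<in> h ` f ` fst c" for w
  proof -
    obtain q where q: "q \<in> fst c" "w = h (f q)"
      using w by blast
    then show ?thesis
      using chart_inj[OF c] inv_into_f_f[OF inj_h, of "f q"] by (simp add: h L_inverse inv_into_f_f)
  qed
  ultimately have sm: "smooth_on (h ` f ` fst c) (inv_into (f ` fst c) h)"
    by (rule iffD1[OF smooth_on_cong[OF op], rotated])
  have "openin (top_of_set S) (f ` fst c)"
    unfolding W(2) using W(1) by blast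
  moreover have "\<exists>W g. open W \<and> x \<in> W \<and> smooth_on W g \<and> (\<forall>y\<in>W \<inter> f ` fst c. g y = h y)"
    if "x \<in> f ` fst c" for x
  proof (intro exI conjI)
    show "smooth_on W (\<lambda>y. L (g y))"
      by (rule smooth_on_linear[OF linear(1) W(1) W(3)])
    show "\<forall>y\<in>W \<inter> f ` fst c. L (g y) = h y"
      using W(4) h by auto
  qed (use W that in auto)
  ultimately show ?thesis
    using inj_h op sm unfolding h_def[symmetric] by (simp add: submanifold_def)
qed

lemma cover_N: "(\<Union>c\<in>charts N. fst c) = S"
proof
  show "(\<Union>c\<in>charts N. fst c) \<subseteq> S"
    using submanifold_chartD(1) openin_imp_subset by blast
  show "S \<subseteq> (\<Union>c\<in>charts N. fst c)"
  proof
    fix y assume "y \<in> S"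
    then obtain q where "q \<in> points M" "y = f q"
      using image_points by blast
    then obtain c where "c \<in> charts M" "q \<in> fst c"
      using cover by blast
    then show "y \<in> (\<Union>c\<in>charts N. fst c)"
      using transported_chart[of c] \<open>y = f q\<close> by force
  qed
qed

lemma smooth_map_f: "smooth_map M N f"
  unfolding smooth_map_def
proof (intro conjI ballI)
  show "f ` points M \<subseteq> points N" "continuous_on (points M) f"
    using image_points continuous points_N by simp_all
  fix c d assume c: "c \<in> charts M" and d: "d \<in> charts N"
  obtain T where T: "open T" "fst d = S \<inter> T"
    using submanifold_chartD(1)[OF d] by (auto simp: openin_open)
  have "fst c \<inter> f -` fst d = fst c \<inter> f -` T"
    using T(2) image_points chart_subset[OF c] by auto
  then have op: "open (snd c ` (fst c \<inter> f -` fst d))"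
    using open_chart_overlap[OF c T(1)] by simp
  show "smooth_on (snd c ` (fst c \<inter> f -` fst d)) (snd d \<circ> f \<circ> chart_inv c)"
    unfolding comp_def
    by (rule smooth_on_submanifold_chart[OF d op smooth_on_subset[OF smooth_chart[OF c]]])
      (use chart_inj[OF c] in \<open>auto simp: inv_into_f_f\<close>)
qed

text \<open>On \<open>S \<inter> W\<close>, the inverse followed by a chart of the source is the
  ambient function \<open>g\<close>. The coordinate expression is therefore \<open>g\<close> after
  the smooth inverse of an arbitrary chart of \<open>S\<close>.\<close>

lemma smooth_map_f_inv: "smooth_map N M f_inv"
  unfolding smooth_map_def
proof (intro conjI ballI)
  show "f_inv ` points N \<subseteq> points M" "continuous_on (points N) f_inv"
    using f_inv continuous_f_inv points_N by auto
  fix c d assume c: "c \<in> charts N" and d: "d \<in> charts M"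
  note cD = submanifold_chartD[OF c]
  obtain W g where W: "open W" "smooth_on W g" "\<And>q. q \<in> points M \<Longrightarrow> f q \<in> W \<longleftrightarrow> q \<in> fst d"
    "\<And>q. q \<in> fst d \<Longrightarrow> g (f q) = snd d q"
    using chart_left_inverse[OF d] by metis
  have sub: "fst c \<subseteq> S"
    using cD(1) openin_imp_subset by blast
  have W': "y \<in> W \<longleftrightarrow> f_inv y \<in> fst d" if "y \<in> S" for y
    using W(3) f_inv[OF that] by metis
  let ?V = "snd c ` (fst c \<inter> f_inv -` fst d)"
  have "?V = snd c ` (fst c \<inter> W)"
    using sub W' by (intro arg_cong[where f = "image (snd c)"]) auto
  also have "\<dots> = snd c ` fst c \<inter> chart_inv c -` W"
    by (rule image_chart_Int[OF cD(2)])
  finally have V: "?V = snd c ` fst c \<inter> chart_inv c -` W" .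
  have op: "open ?V"
    unfolding V
    by (rule continuous_open_preimage[OF smooth_on_imp_continuous_on[OF cD(4)] cD(3) W(1)])
  have "smooth_on ?V (\<lambda>z. g (chart_inv c z))"
    by (rule smooth_on_compose[OF op W(1) _ smooth_on_subset[OF cD(4)] W(2)]) (auto simp: V)
  moreover have "g (chart_inv c z) = (snd d \<circ> f_inv \<circ> chart_inv c) z" if z: "z \<in> ?V" for z
  proof -
    obtain y where y: "z = snd c y" "y \<in> fst c" "f_inv y \<in> fst d"
      using z by auto
    then have "g y = snd d (f_inv y)"
      using W(4) f_inv sub by (metis subsetD)
    then show ?thesis
      using y cD(2) by (simp add: inv_into_f_f)
  qed
  ultimately show "smooth_on ?V (snd d \<circ> f_inv \<circ> chart_inv c)"
    using smooth_on_cong[OF op] by metis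
qed

theorem diffeomorphism: "diffeomorphism M N f"
  unfolding diffeomorphism_def
  using smooth_manifold smooth_manifold_submanifold[OF cover_N] smooth_map_f smooth_map_f_inv
    bij points_N by simp

text \<open>The chain rule for the inclusion after \<open>f\<close>. It turns the intrinsic line
  element of the image, read through two nested differentials, into the Euclidean length of the
  derivative of \<open>f\<close>.\<close>

lemma euclidean_vector_inclusion_differential:
  assumes p: "p \<in> points M"
  shows "euclidean_vector (differential N euclidean_manifold (\<lambda>x. x) (f p) (differential M N f p v)) =
    euclidean_vector (differential M euclidean_manifold f p v)"
proof -
  define c where "c = (SOME c. c \<in> charts_at M p)"
  \<comment> \<open>The chart that the differential of the inclusion selects; only this component of
    the inner differential is read.\<close>
  define d where "d = (SOME d. d \<in> charts_at N (f p))"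
  have c: "c \<in> charts M" "p \<in> fst c"
    using someI_charts_at[OF p] by (simp_all add: c_def)
  have "\<exists>d. d \<in> charts_at N (f p)"
    using p image_points cover_N unfolding charts_at_def by blast
  then have d_at: "d \<in> charts_at N (f p)"
    unfolding d_def by (rule someI_ex)
  then have d: "d \<in> charts N" "f p \<in> fst d"
    by (simp_all add: charts_at_def)
  note dD = submanifold_chartD[OF d(1)]
  have cp: "chart_inv c (snd c p) = p"
    using c chart_inj by (simp add: inv_into_f_f)
  have dp: "chart_inv d (snd d (f p)) = f p"
    using d dD by (simp add: inv_into_f_f)
  obtain T where T: "open T" "fst d = S \<inter> T"
    using dD(1) by (auto simp: openin_open)
  have "fst c \<inter> f -` fst d = fst c \<inter> f -` T"
    using T(2) image_points chart_subset[OF c(1)] by auto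
  then have op: "open (snd c ` (fst c \<inter> f -` fst d))" (is "open ?V")
    using open_chart_overlap[OF c(1) T(1)] by simp
  have pV: "snd c p \<in> ?V"
    using c d by auto
  have mem: "f (chart_inv c z) \<in> fst d" if "z \<in> ?V" for z
    using that chart_inj[OF c(1)] by (auto simp: inv_into_f_f)
  have sm: "smooth_on ?V (\<lambda>z. snd d (f (chart_inv c z)))"
    using smooth_map_f c(1) d(1) by (simp add: smooth_map_def comp_def)
  let ?g = "frechet_derivative (\<lambda>z. snd d (f (chart_inv c z))) (at (snd c p))"
  let ?h = "frechet_derivative (chart_inv d) (at (snd d (f p)))"
  have "frechet_derivative (\<lambda>z. f (chart_inv c z)) (at (snd c p)) (v c) = ?h (?g (v c))"
  proof (rule frechet_derivative_compose_at[OF smooth_on_has_derivative[OF sm pV] _ op pV])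
    show "(chart_inv d has_derivative ?h) (at (snd d (f (chart_inv c (snd c p)))))"
      unfolding cp using smooth_on_has_derivative[OF dD(4)] d(2) by blast
    show "f (chart_inv c z) = chart_inv d (snd d (f (chart_inv c z)))" if "z \<in> ?V" for z
      using mem[OF that] dD(2) by (simp add: inv_into_f_f)
  qed
  moreover have "differential M N f p v d = ?g (v c)"
    using d_at by (simp add: differential_def c_def[symmetric] comp_def)
  ultimately show ?thesis
    by (simp add: euclidean_vector_differential c_def[symmetric] d_def[symmetric] comp_def)
qed

end

section \<open>The affine charts of the projective line\<close>

lemma mem_line_of_proj_point:
  assumes "v \<noteq> 0"
  shows "w \<in> line_of (proj_point v) \<longleftrightarrow> (\<exists>k. w = k *s v)"
proof -
  have "line_of (proj_point v) = vec.span {v}"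
    unfolding proj_point_def using Abs_cp1_inverse[of "vec.span {v}"] span_in_cp1[OF assms] by simp
  then show ?thesis
    by (auto simp: vec.span_singleton)
qed

lemma self_mem_line_of_proj_point: "v \<noteq> 0 \<Longrightarrow> v \<in> line_of (proj_point v)"
  by (auto simp: mem_line_of_proj_point intro: exI[of _ 1])

lemma proj_point_eqI:
  assumes "v \<in> line_of p" "v \<noteq> 0"
  shows "proj_point v = p"
  unfolding proj_point_def line_of_span[OF assms, symmetric] by (rule line_of_inverse)

lemma proj_point_cases:
  obtains v where "v \<noteq> 0" "p = proj_point v"
proof -
  have "vec.dim (line_of p) \<noteq> 0"
    using line_of[of p] by simp
  then have "\<not> line_of p \<subseteq> {0}"
    using vec.dim_eq_0 by metis
  then obtain v where "v \<in> line_of p" "v \<noteq> 0"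
    by blast
  with that show ?thesis
    using proj_point_eqI by metis
qed

lemma proj_point_scale:
  assumes "v \<noteq> 0" "k \<noteq> 0"
  shows "proj_point (k *s v) = proj_point v"
  by (rule proj_point_eqI) (use assms in \<open>auto simp: mem_line_of_proj_point\<close>)

lemma proj_point_in_affine_domainI:
  assumes "v $ i \<noteq> 0"
  shows "proj_point v \<in> affine_domain i"
proof -
  have "v \<noteq> 0" using assms by auto
  then show ?thesis
    using assms self_mem_line_of_proj_point unfolding affine_domain_def by blast
qed

lemma proj_point_in_affine_domain:
  assumes "v \<noteq> 0"
  shows "proj_point v \<in> affine_domain i \<longleftrightarrow> v $ i \<noteq> 0"
  using proj_point_in_affine_domainI[of v i]
  by (auto simp: affine_domain_def mem_line_of_proj_point[OF assms])

lemma affine_coord_proj_point: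
  assumes "v $ i \<noteq> 0"
  shows "affine_coord i j (proj_point v) = v $ j / v $ i"
proof -
  have v: "v \<noteq> 0" using assms by auto
  show ?thesis
    unfolding affine_coord_def
  proof (rule the_equality)
    show "\<forall>w\<in>line_of (proj_point v). w $ j = v $ j / v $ i * w $ i"
      using assms by (auto simp: mem_line_of_proj_point[OF v])
    show "z = v $ j / v $ i" if "\<forall>w\<in>line_of (proj_point v). w $ j = z * w $ i" for z
      using bspec[OF that self_mem_line_of_proj_point[OF v]] assms by simp
  qed
qed

definition affine_vector :: "2 \<Rightarrow> complex \<Rightarrow> complex^2" where
  "affine_vector i z = (\<chi> k. if k = i then 1 else z)"

lemma affine_vector_nth [simp]:
  "affine_vector i z $ i = 1" "k \<noteq> i \<Longrightarrow> affine_vector i z $ k = z"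
  by (simp_all add: affine_vector_def)

lemma affine_vector_nonzero [simp]: "affine_vector i z \<noteq> 0"
  by (metis affine_vector_nth(1) zero_index zero_neq_one)

lemma other_index: "i \<noteq> j \<Longrightarrow> k \<noteq> i \<Longrightarrow> k = (j::2)"
  by (metis exhaust_2)

lemma proj_point_affine_vector:
  assumes "v $ i \<noteq> 0" "i \<noteq> j"
  shows "proj_point (affine_vector i (v $ j / v $ i)) = proj_point v"
proof -
  have v: "v \<noteq> 0" using assms by auto
  have "affine_vector i (v $ j / v $ i) = inverse (v $ i) *s v"
    unfolding vec_eq_iff
  proof
    fix k
    show "affine_vector i (v $ j / v $ i) $ k = (inverse (v $ i) *s v) $ k"
      using assms(1) other_index[OF assms(2), of k]
      by (cases "k = i") (auto simp: divide_inverse)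
  qed
  then show ?thesis
    using proj_point_scale[OF v] assms by simp
qed

text \<open>Indexing by ordered pairs of distinct indices lets later arguments treat both charts at
  once.\<close>

lemma charts_CP1:
  "c \<in> charts CP1 \<longleftrightarrow> (\<exists>i j. i \<noteq> j \<and> c = (affine_domain i, affine_coord i j))"
proof
  assume "c \<in> charts CP1"
  then consider "c = (affine_domain 1, affine_coord 1 2)" | "c = (affine_domain 2, affine_coord 2 1)"
    unfolding CP1_def by auto
  then show "\<exists>i j. i \<noteq> j \<and> c = (affine_domain i, affine_coord i j)"
  proof cases
    case 1
    then show ?thesis by (intro exI[of _ 1] exI[of _ 2]) simp
  next
    case 2
    then show ?thesis by (intro exI[of _ 2] exI[of _ 1]) simp
  qed
next
  assume "\<exists>i j. i \<noteq> j \<and> c = (affine_domain i, affine_coord i j)"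
  then show "c \<in> charts CP1"
    unfolding CP1_def using exhaust_2 by (auto, (metis exhaust_2)+)
qed

lemma points_CP1 [simp]: "points CP1 = UNIV"
  by (simp add: CP1_def)

lemma affine_domain_cover: "\<exists>i. p \<in> affine_domain i"
proof -
  obtain v where v: "v \<noteq> 0" "p = proj_point v"
    by (rule proj_point_cases)
  then have "\<exists>i. v $ i \<noteq> 0"
    by (simp add: vec_eq_iff)
  with v show ?thesis
    by (simp add: proj_point_in_affine_domain)
qed

lemma exists_other_index: "\<exists>j. (i::2) \<noteq> j"
  by (metis one_neq_zero)

context
  fixes i j :: 2
  assumes ij: "i \<noteq> j"
begin

lemma affine_vector_mem_affine_domain: "proj_point (affine_vector i z) \<in> affine_domain i"
  by (simp add: proj_point_in_affine_domain)

lemma affine_coord_affine_vector: "affine_coord i j (proj_point (affine_vector i z)) = z"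
  using ij by (simp add: affine_coord_proj_point)

lemma affine_vector_affine_coord:
  assumes "p \<in> affine_domain i"
  shows "proj_point (affine_vector i (affine_coord i j p)) = p"
proof -
  obtain v where v: "v \<noteq> 0" "p = proj_point v"
    by (rule proj_point_cases)
  then have "v $ i \<noteq> 0"
    using assms by (simp add: proj_point_in_affine_domain)
  then show ?thesis
    using v ij by (simp add: affine_coord_proj_point proj_point_affine_vector)
qed

lemma image_affine_coord: "affine_coord i j ` affine_domain i = UNIV"
  using affine_coord_affine_vector affine_vector_mem_affine_domain by (metis UNIV_eq_I image_eqI)

lemma inj_on_affine_coord: "inj_on (affine_coord i j) (affine_domain i)"
  by (rule inj_on_inverseI[where g = "\<lambda>z. proj_point (affine_vector i z)"])
    (rule affine_vector_affine_coord)

lemma inv_into_affine_coord: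
  "inv_into (affine_domain i) (affine_coord i j) = (\<lambda>z. proj_point (affine_vector i z))"
proof
  fix z
  show "inv_into (affine_domain i) (affine_coord i j) z = proj_point (affine_vector i z)"
    using inv_into_f_eq[OF inj_on_affine_coord affine_vector_mem_affine_domain
        affine_coord_affine_vector] .
qed

lemma affine_vector_eq: "affine_vector i z = axis i 1 + axis j z"
  using ij other_index[OF ij] by (auto simp: affine_vector_def vec_eq_iff axis_def)

lemma smooth_on_affine_vector: "smooth_on UNIV (affine_vector i)"
proof -
  have "linear (axis j :: complex \<Rightarrow> complex^2)"
    by (rule linearI) (simp_all add: vec_eq_iff axis_def)
  then have "smooth_on UNIV (\<lambda>z. axis i 1 + axis j z :: complex^2)"
    by (intro smooth_on_add smooth_on_const smooth_on_linear[where L = "axis j"] smooth_on_id)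
      (simp_all add: linear_conv_bounded_linear)
  then show ?thesis
    unfolding affine_vector_eq[abs_def] .
qed

end

section \<open>Topology of the affine charts\<close>

lemma continuous_on_proj_point: "continuous_on {v. v \<noteq> 0} proj_point"
proof -
  have "open {v :: complex^2. v \<noteq> 0}"
    by (simp add: open_Collect_neq)
  moreover have "open (proj_point -` U \<inter> {v. v \<noteq> 0})" if "open U" for U
    using that unfolding open_cp1_def by (simp add: vimage_def Collect_conj_eq[symmetric] conj_commute)
  ultimately show ?thesis
    by (simp add: continuous_on_open_vimage)
qed

lemma open_affine_domain: "open (affine_domain i)"
proof -
  have "{v. v \<noteq> 0 \<and> proj_point v \<in> affine_domain i} = {v. v $ i \<noteq> 0}"
    by (auto simp: proj_point_in_affine_domain proj_point_in_affine_domainI)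
  then show ?thesis
    unfolding open_cp1_def by (auto intro!: open_Collect_neq continuous_intros)
qed

lemma continuous_on_affine_coord: "continuous_on (affine_domain i) (affine_coord i j)"
proof -
  have "open (affine_coord i j -` B \<inter> affine_domain i)" if "open B" for B
  proof -
    have "{v. v \<noteq> 0 \<and> proj_point v \<in> affine_coord i j -` B \<inter> affine_domain i} =
        {v. v $ i \<noteq> 0} \<inter> (\<lambda>v. v $ j / v $ i) -` B"
      by (auto simp: proj_point_in_affine_domain proj_point_in_affine_domainI affine_coord_proj_point)
    moreover have "open \<dots>"
      using that by (intro continuous_open_preimage)
        (auto intro!: open_Collect_neq continuous_intros)
    ultimately show ?thesis
      unfolding open_cp1_def by simp
  qed
  then show ?thesis
    by (simp add: continuous_on_open_vimage open_affine_domain)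
qed

lemma homeomorphism_affine_coord:
  assumes "i \<noteq> j"
  shows "homeomorphism (affine_domain i) UNIV (affine_coord i j) (\<lambda>z. proj_point (affine_vector i z))"
proof (rule homeomorphismI)
  show "continuous_on UNIV (\<lambda>z. proj_point (affine_vector i z))"
    by (rule continuous_on_compose2[OF continuous_on_proj_point
          smooth_on_imp_continuous_on[OF smooth_on_affine_vector[OF assms]]]) auto
qed (simp_all add: assms continuous_on_affine_coord image_subset_iff affine_vector_mem_affine_domain[OF assms]
    affine_coord_affine_vector affine_vector_affine_coord)

section \<open>The density map in coordinates\<close>

lemma trunc_eqI:
  assumes "q \<bullet> 1 = r \<bullet> 1" "q \<bullet> eps = r \<bullet> eps" "q \<bullet> eps\<^sup>2 = r \<bullet> (eps\<^sup>2 :: trunc)"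
  shows "q = r"
  by (rule euclidean_eqI) (use assms in \<open>auto simp: Basis_trunc_def\<close>)

lemma inner_trunc_combination:
  "(a *\<^sub>R 1 + b *\<^sub>R eps + c *\<^sub>R eps\<^sup>2) \<bullet> 1 = a"
  "(a *\<^sub>R 1 + b *\<^sub>R eps + c *\<^sub>R eps\<^sup>2) \<bullet> eps = b"
  "(a *\<^sub>R 1 + b *\<^sub>R eps + c *\<^sub>R eps\<^sup>2) \<bullet> eps\<^sup>2 = c"
  by (simp_all add: inner_add_left inner_monomials inner_monomials[THEN trans[OF inner_commute]])

lemma inner_trunc_combination_self:
  "(a *\<^sub>R 1 + b *\<^sub>R eps + c *\<^sub>R eps\<^sup>2) \<bullet> (a *\<^sub>R 1 + b *\<^sub>R eps + c *\<^sub>R eps\<^sup>2) = a\<^sup>2 + b\<^sup>2 + c\<^sup>2"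
  by (subst inner_trunc_eq, simp only: inner_trunc_combination) (simp only: power2_eq_square)

lemma density_map_combination:
  "of_real a + of_real b * eps + of_real c * eps\<^sup>2 = a *\<^sub>R 1 + b *\<^sub>R eps + c *\<^sub>R (eps\<^sup>2 :: trunc)"
  by (simp add: of_real_def)

lemma mem_S2T_iff: "q \<in> S2T \<longleftrightarrow> (q \<bullet> 1 - 1/2)\<^sup>2 + (q \<bullet> eps)\<^sup>2 + (q \<bullet> eps\<^sup>2)\<^sup>2 = 1"
proof
  assume "q \<in> S2T"
  then show "(q \<bullet> 1 - 1/2)\<^sup>2 + (q \<bullet> eps)\<^sup>2 + (q \<bullet> eps\<^sup>2)\<^sup>2 = 1"
    unfolding S2T_def density_map_combination by (auto simp: inner_trunc_combination)
next
  let ?x = "q \<bullet> 1 - 1/2"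
  assume "?x\<^sup>2 + (q \<bullet> eps)\<^sup>2 + (q \<bullet> eps\<^sup>2)\<^sup>2 = 1"
  moreover have "q = of_real (1/2 + ?x) + of_real (q \<bullet> eps) * eps + of_real (q \<bullet> eps\<^sup>2) * eps\<^sup>2"
    unfolding density_map_combination by (rule trunc_eqI) (simp_all add: inner_trunc_combination)
  ultimately show "q \<in> S2T"
    unfolding S2T_def by blast
qed

lemma S2T_eq_sphere: "S2T = sphere (of_real (1/2)) 1"
proof -
  have "q \<in> S2T \<longleftrightarrow> dist (of_real (1/2)) q = 1" for q
  proof -
    \<comment> \<open>The zero coefficients are written out so that the centre matches
      \<open>inner_trunc_combination\<close>.\<close>
    let ?c = "(1/2) *\<^sub>R 1 + 0 *\<^sub>R eps + 0 *\<^sub>R (eps\<^sup>2) :: trunc"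
    have c: "of_real (1/2) = ?c"
      by (simp add: of_real_def)
    have "(dist ?c q)\<^sup>2 = (q - ?c) \<bullet> (q - ?c)"
      by (metis dist_commute dist_norm power2_norm_eq_inner)
    also have "\<dots> = (q \<bullet> 1 - 1/2)\<^sup>2 + (q \<bullet> eps)\<^sup>2 + (q \<bullet> eps\<^sup>2)\<^sup>2"
      unfolding inner_trunc_eq[of "q - ?c" "q - ?c"] inner_diff_left[of q ?c 1]
        inner_diff_left[of q ?c eps] inner_diff_left[of q ?c "eps\<^sup>2"] inner_trunc_combination
      by (simp only: power2_eq_square diff_zero)
    finally show ?thesis
      unfolding c mem_S2T_iff by (metis abs_1 abs_of_nonneg one_power2 power2_eq_iff_nonneg zero_le_dist zero_le_one)
  qed
  then show ?thesis by (auto simp: sphere_def)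
qed

text \<open>The coordinates $2\,\mathrm{Re}(\bar a b)$, $2\,\mathrm{Im}(\bar a b)$ and
  $|a|^2 - |b|^2$ of the Hopf map, written with real inner products so that they are visibly
  bilinear over the reals.\<close>

definition hopf :: "complex^2 \<Rightarrow> trunc" where
  "hopf v = (2 * (v $ 1 \<bullet> v $ 2)) *\<^sub>R 1 + (2 * ((\<i> * v $ 1) \<bullet> v $ 2)) *\<^sub>R eps +
     (v $ 1 \<bullet> v $ 1 - v $ 2 \<bullet> v $ 2) *\<^sub>R eps\<^sup>2"

definition hopf_derivative :: "complex^2 \<Rightarrow> complex^2 \<Rightarrow> trunc" where
  "hopf_derivative v w =
     (2 * (v $ 1 \<bullet> w $ 2 + w $ 1 \<bullet> v $ 2)) *\<^sub>R 1 +
     (2 * ((\<i> * v $ 1) \<bullet> w $ 2 + (\<i> * w $ 1) \<bullet> v $ 2)) *\<^sub>R eps +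
     (v $ 1 \<bullet> w $ 1 + w $ 1 \<bullet> v $ 1 - (v $ 2 \<bullet> w $ 2 + w $ 2 \<bullet> v $ 2)) *\<^sub>R eps\<^sup>2"

text \<open>The conjugate off-diagonal entries give the first two Pauli traces and the diagonal the
  third; the 1/2 is the shift in the density map.\<close>

lemma density_map_ketbra: "density_map (ketbra v v) = (1/2) *\<^sub>R 1 + hopf v"
proof -
  have "Re (trace (ketbra v v ** pauli_x)) = 2 * (v $ 1 \<bullet> v $ 2)"
    "Re (trace (ketbra v v ** pauli_y)) = 2 * ((\<i> * v $ 1) \<bullet> v $ 2)"
    "Re (trace (ketbra v v ** pauli_z)) = v $ 1 \<bullet> v $ 1 - v $ 2 \<bullet> v $ 2"
    by (simp_all add: trace_def matrix_matrix_mult_def ketbra_def pauli_x_def pauli_y_def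
        pauli_z_def sum_2 vector_2 inner_complex_def)
  then show ?thesis
    unfolding density_map_def Let_def density_map_combination hopf_def
    by (simp only: scaleR_add_left add.assoc)
qed

lemma hopf_scaleR: "hopf (r *\<^sub>R v) = r\<^sup>2 *\<^sub>R hopf v"
  by (simp add: hopf_def power2_eq_square algebra_simps)

lemma Psi_unit:
  assumes "v \<in> line_of p" "norm v = 1"
  shows "Psi p = (1/2) *\<^sub>R 1 + hopf v"
  using projector_eq_ketbra[OF assms] by (simp add: Psi_def density_map_ketbra)

lemma scaleR_eq_smult: "r *\<^sub>R v = complex_of_real r *s (v :: complex^2)"
  unfolding vec_eq_iff vector_scaleR_component vector_smult_component
  by (simp add: scaleR_conv_of_real)

text \<open>As \<open>hopf\<close> is homogeneous of degree two over the reals, normalising a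
  representative costs only the factor \<open>inverse (v \<bullet> v)\<close>. No square root
  remains, so smoothness in the charts needs only a nonvanishing denominator.\<close>

lemma Psi_proj_point:
  assumes "v \<noteq> 0"
  shows "Psi (proj_point v) = (1/2) *\<^sub>R 1 + inverse (v \<bullet> v) *\<^sub>R hopf v"
proof -
  have "inverse (norm v) *\<^sub>R v \<in> line_of (proj_point v)"
    unfolding scaleR_eq_smult mem_line_of_proj_point[OF assms] by blast
  moreover have "norm (inverse (norm v) *\<^sub>R v) = 1"
    using assms by simp
  ultimately have "Psi (proj_point v) = (1/2) *\<^sub>R 1 + hopf (inverse (norm v) *\<^sub>R v)"
    by (rule Psi_unit)
  then show ?thesis
    by (simp add: hopf_scaleR power_inverse power2_norm_eq_inner)
qed

lemma smooth_on_hopf: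
  assumes "open S" "smooth_on S u"
  shows "smooth_on S (\<lambda>x. hopf (u x))"
proof -
  have "smooth_on S (\<lambda>x. u x $ k)" for k
    using smooth_on_linear[OF bounded_linear_vec_nth assms] .
  then show ?thesis
    unfolding hopf_def
    by (intro smooth_on_add smooth_on_diff smooth_on_scaleR smooth_on_mult smooth_on_inner
        smooth_on_const assms(1))
qed

lemma hopf_has_derivative: "(hopf has_derivative hopf_derivative v) (at v)"
proof -
  have nth: "((\<lambda>v. v $ k) has_derivative (\<lambda>w. w $ k)) (at v)" for k
    by (rule bounded_linear_imp_has_derivative[OF bounded_linear_vec_nth])
  note inner = has_derivative_inner[OF nth nth]
    has_derivative_inner[OF has_derivative_mult_right[OF nth, of \<i>] nth]
  show ?thesis
    unfolding hopf_def[abs_def] hopf_derivative_def[abs_def]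
    by (intro has_derivative_add has_derivative_scaleR_left has_derivative_mult_right
        has_derivative_diff inner)
qed

lemma inner_complex_vec2: "(v :: complex^2) \<bullet> w = v $ 1 \<bullet> w $ 1 + v $ 2 \<bullet> w $ 2"
  by (simp add: inner_vec_def sum_2)

lemma Psi_coordinates:
  assumes "v \<noteq> 0"
  shows "Psi (proj_point v) \<bullet> 1 = 1/2 + 2 * (v $ 1 \<bullet> v $ 2) / (v \<bullet> v)"
    "Psi (proj_point v) \<bullet> eps = 2 * ((\<i> * v $ 1) \<bullet> v $ 2) / (v \<bullet> v)"
    "Psi (proj_point v) \<bullet> eps\<^sup>2 = (v $ 1 \<bullet> v $ 1 - v $ 2 \<bullet> v $ 2) / (v \<bullet> v)"
proof -
  have shift: "(1/2) *\<^sub>R 1 + r *\<^sub>R (a *\<^sub>R 1 + b *\<^sub>R eps + c *\<^sub>R eps\<^sup>2) =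
      (1/2 + r * a) *\<^sub>R 1 + (r * b) *\<^sub>R eps + (r * c) *\<^sub>R (eps\<^sup>2 :: trunc)" for r a b c
    by (simp add: scaleR_add_left scaleR_add_right)
  show "Psi (proj_point v) \<bullet> 1 = 1/2 + 2 * (v $ 1 \<bullet> v $ 2) / (v \<bullet> v)"
    "Psi (proj_point v) \<bullet> eps = 2 * ((\<i> * v $ 1) \<bullet> v $ 2) / (v \<bullet> v)"
    "Psi (proj_point v) \<bullet> eps\<^sup>2 = (v $ 1 \<bullet> v $ 1 - v $ 2 \<bullet> v $ 2) / (v \<bullet> v)"
    unfolding Psi_proj_point[OF assms] hopf_def shift inner_trunc_combination
    by (simp_all only: divide_inverse mult.commute)
qed

text \<open>For components a and b, the first two coordinates contribute 4 |a|^2 |b|^2, completing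
  (|a|^2 - |b|^2)^2 to (|a|^2 + |b|^2)^2.\<close>

lemma Psi_mem_S2T: "Psi p \<in> S2T"
proof -
  obtain v where v: "v \<noteq> 0" "p = proj_point v"
    by (rule proj_point_cases)
  have n: "v \<bullet> v \<noteq> 0"
    using v by simp
  have "(2 * (v $ 1 \<bullet> v $ 2))\<^sup>2 + (2 * ((\<i> * v $ 1) \<bullet> v $ 2))\<^sup>2 + (v $ 1 \<bullet> v $ 1 - v $ 2 \<bullet> v $ 2)\<^sup>2 =
      (v \<bullet> v)\<^sup>2"
    unfolding inner_complex_vec2 inner_complex_def
    by (simp add: power2_eq_square algebra_simps)
  then show ?thesis
    unfolding mem_S2T_iff v(2) Psi_coordinates[OF v(1)] using n
    by (simp add: power_divide add_divide_distrib[symmetric])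
qed

text \<open>Stereographic projection from the pole \<open>(0, 0, -1)\<close> for \<open>i = 1\<close>, and from \<open>(0, 0, 1)\<close>
  followed by complex conjugation for \<open>i = 2\<close>; it inverts \<open>Psi\<close> in the \<open>i\<close>-th affine chart.\<close>

definition pole_sign :: "2 \<Rightarrow> real" where
  "pole_sign i = (if i = 1 then 1 else - 1)"

lemma pole_sign_simps: "pole_sign 1 = 1" "pole_sign 2 = - 1"
  by (simp_all add: pole_sign_def)

definition stereographic :: "2 \<Rightarrow> trunc \<Rightarrow> complex" where
  "stereographic i q = inverse (1 + pole_sign i * (q \<bullet> eps\<^sup>2)) *\<^sub>R
     ((q \<bullet> 1 - 1/2) *\<^sub>R 1 + (pole_sign i * (q \<bullet> eps)) *\<^sub>R \<i>)"

text \<open>The complement of the tangent plane at the pole: open in the whole algebra, and on the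
  sphere it omits the pole alone.\<close>

definition stereographic_domain :: "2 \<Rightarrow> trunc set" where
  "stereographic_domain i = {q. 1 + pole_sign i * (q \<bullet> eps\<^sup>2) \<noteq> 0}"

lemma open_stereographic_domain: "open (stereographic_domain i)"
  unfolding stereographic_domain_def by (intro open_Collect_neq continuous_intros)

lemma smooth_on_stereographic: "smooth_on (stereographic_domain i) (stereographic i)"
  unfolding stereographic_def[abs_def]
  by (intro smooth_on_scaleR smooth_on_inverse smooth_on_add smooth_on_diff smooth_on_mult
      smooth_on_inner smooth_on_const smooth_on_id open_stereographic_domain)
    (simp add: stereographic_domain_def)

text \<open>The denominator vanishes exactly when the component \<open>v $ i\<close> does, so the
  pole corresponds to the point missing from the affine chart.\<close>

lemma stereographic_denominator:
  assumes "v \<noteq> 0"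
  shows "1 + pole_sign i * (Psi (proj_point v) \<bullet> eps\<^sup>2) = 2 * (v $ i \<bullet> v $ i) / (v \<bullet> v)"
proof -
  have "v \<bullet> v \<noteq> 0"
    using assms by simp
  then have "v $ 1 \<bullet> v $ 1 + v $ 2 \<bullet> v $ 2 \<noteq> 0"
    by (metis inner_complex_vec2)
  moreover have "1 + (a - b) / (a + b) = 2 * a / (a + b)" "1 + (b - a) / (a + b) = 2 * b / (a + b)"
    if "a + b \<noteq> 0" for a b :: real
    using that by (simp_all add: divide_simps)
  ultimately show ?thesis
    unfolding Psi_coordinates[OF assms] inner_complex_vec2[of v v]
    using exhaust_2[of i] by (elim disjE) (simp_all add: pole_sign_simps)
qed

lemma Psi_mem_stereographic_domain: "Psi p \<in> stereographic_domain i \<longleftrightarrow> p \<in> affine_domain i"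
proof -
  obtain v where v: "v \<noteq> 0" "p = proj_point v"
    by (rule proj_point_cases)
  then show ?thesis
    unfolding stereographic_domain_def mem_Collect_eq v(2) stereographic_denominator[OF v(1)]
    by (simp add: proj_point_in_affine_domain)
qed

lemma stereographic_Psi:
  assumes "i \<noteq> j" "p \<in> affine_domain i"
  shows "stereographic i (Psi p) = affine_coord i j p"
proof -
  obtain v where v: "v \<noteq> 0" "p = proj_point v"
    by (rule proj_point_cases)
  then have vi: "v $ i \<noteq> 0"
    using assms by (simp add: proj_point_in_affine_domain)
  have n: "v \<bullet> v \<noteq> 0"
    using v by simp
  \<comment> \<open>The sign conjugates \<open>cnj (v $ 1) * v $ 2\<close> when
    \<open>i = 2\<close>; division by \<open>v $ i \<bullet> v $ i\<close> then leaves the affine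
    coordinate.\<close>
  have "(v $ 1 \<bullet> v $ 2) *\<^sub>R 1 + (pole_sign i * ((\<i> * v $ 1) \<bullet> v $ 2)) *\<^sub>R \<i> = v $ j * cnj (v $ i)"
    using exhaust_2[of i] exhaust_2[of j] assms(1)
    by (auto simp: pole_sign_def complex_eq_iff inner_complex_def)
  moreover have "stereographic i (Psi p) = inverse (2 * (v $ i \<bullet> v $ i) / (v \<bullet> v)) *\<^sub>R
      ((2 / (v \<bullet> v)) *\<^sub>R ((v $ 1 \<bullet> v $ 2) *\<^sub>R 1 + (pole_sign i * ((\<i> * v $ 1) \<bullet> v $ 2)) *\<^sub>R \<i>))"
    unfolding stereographic_def v(2) stereographic_denominator[OF v(1)]
    unfolding Psi_coordinates[OF v(1)]
    by (simp add: scaleR_add_right)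
  ultimately have "stereographic i (Psi p) = inverse (v $ i \<bullet> v $ i) *\<^sub>R (v $ j * cnj (v $ i))"
    using n by (simp add: inverse_eq_divide)
  also have "\<dots> = v $ j / v $ i"
    unfolding complex_div_cnj[of "v $ j"]
    by (simp add: scaleR_conv_of_real power2_norm_eq_inner[symmetric] divide_inverse)
  finally show ?thesis
    using v vi by (simp add: affine_coord_proj_point)
qed

text \<open>The value of \<open>Psi\<close> reveals an affine domain containing the point, and there
  the stereographic projection recovers its coordinate.\<close>

lemma inj_Psi: "inj Psi"
proof (rule injI)
  fix p q assume eq: "Psi p = Psi q"
  obtain i where p: "p \<in> affine_domain i"
    using affine_domain_cover by blast
  then have q: "q \<in> affine_domain i"
    using eq Psi_mem_stereographic_domain by metis
  obtain j where j: "i \<noteq> j"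
    using exists_other_index by blast
  show "p = q"
    using inj_onD[OF inj_on_affine_coord[OF j] _ p q] stereographic_Psi[OF j] p q eq by metis
qed

lemma range_Psi: "range Psi = S2T"
proof
  show "range Psi \<subseteq> S2T"
    using Psi_mem_S2T by blast
  show "S2T \<subseteq> range Psi"
  proof
    fix q assume q: "q \<in> S2T"
    define x y z where xyz: "x = q \<bullet> 1 - 1/2" "y = q \<bullet> eps" "z = q \<bullet> eps\<^sup>2"
    have S: "x\<^sup>2 + y\<^sup>2 + z\<^sup>2 = 1"
      using q by (simp add: mem_S2T_iff xyz)
    \<comment> \<open>Twice the projector with Bloch vector \<open>(x, y, z)\<close> has first
      column \<open>(1 + z, x + \<i> y)\<close>, which spans its line. The column vanishes at
      \<open>z = - 1\<close>, where a multiple of the second column is taken.\<close>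
    define v :: "complex^2" where
      "v = (if z = - 1 then vector [0, 1] else vector [complex_of_real (1 + z), Complex x y])"
    have v: "v \<noteq> 0"
    proof (cases "z = - 1")
      case True
      then have "v $ 2 \<noteq> 0" by (simp add: v_def)
      then show ?thesis by auto
    next
      case False
      then have "v $ 1 \<noteq> 0" by (auto simp: v_def complex_eq_iff)
      then show ?thesis by auto
    qed
    have "Psi (proj_point v) = q"
    proof (rule trunc_eqI; unfold Psi_coordinates[OF v])
      have *: "1/2 + 2 * (v $ 1 \<bullet> v $ 2) / (v \<bullet> v) = 1/2 + x \<and>
          2 * ((\<i> * v $ 1) \<bullet> v $ 2) / (v \<bullet> v) = y \<and>
          (v $ 1 \<bullet> v $ 1 - v $ 2 \<bullet> v $ 2) / (v \<bullet> v) = z"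
      proof (cases "z = - 1")
        case True
        then have "x = 0" "y = 0"
          using S by (auto simp: sum_power2_eq_zero_iff)
        with True show ?thesis
          by (simp add: v_def inner_complex_vec2 inner_complex_def)
      next
        case False
        then have v12: "v $ 1 = complex_of_real (1 + z)" "v $ 2 = Complex x y"
          by (simp_all add: v_def)
        have nz: "1 + z \<noteq> 0"
          using False by simp
        \<comment> \<open>The sphere equation reduces (1 + z)^2 + x^2 + y^2 to this.\<close>
        have vv: "v \<bullet> v = 2 * (1 + z)"
          unfolding inner_complex_vec2 v12 inner_complex_def using S
          by (simp add: power2_eq_square algebra_simps)
        have "v $ 1 \<bullet> v $ 1 - v $ 2 \<bullet> v $ 2 = 2 * (1 + z) * z"
          unfolding v12 inner_complex_def using S
          by (simp add: power2_eq_square algebra_simps)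
        moreover have "v $ 1 \<bullet> v $ 2 = (1 + z) * x" "(\<i> * v $ 1) \<bullet> v $ 2 = (1 + z) * y"
          unfolding v12 inner_complex_def by simp_all
        moreover have "2 * ((1 + z) * r) / (2 * (1 + z)) = r" for r
          using nz by (simp only: mult.assoc[symmetric]) simp
        ultimately show ?thesis
          unfolding vv by (simp only: mult.assoc simp_thms)
      qed
      then show "1/2 + 2 * (v $ 1 \<bullet> v $ 2) / (v \<bullet> v) = q \<bullet> 1"
        "2 * ((\<i> * v $ 1) \<bullet> v $ 2) / (v \<bullet> v) = q \<bullet> eps"
        "(v $ 1 \<bullet> v $ 1 - v $ 2 \<bullet> v $ 2) / (v \<bullet> v) = q \<bullet> eps\<^sup>2"
        by (simp_all add: xyz)
    qed
    then show "q \<in> range Psi"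
      by blast
  qed
qed

interpretation Psi: smooth_parametrisation_iso CP1 S2T Psi
  "\<lambda>z. vector [Re z, Im z] :: real^2" "\<lambda>w. Complex (w $ 1) (w $ 2)"
proof (intro smooth_parametrisation_iso.intro smooth_parametrisation.intro
    smooth_parametrisation_iso_axioms.intro)
  show "(\<Union>c\<in>charts CP1. fst c) = points CP1"
  proof -
    have "p \<in> (\<Union>c\<in>charts CP1. fst c)" for p
    proof -
      obtain i where i: "p \<in> affine_domain i"
        using affine_domain_cover by blast
      obtain j where "i \<noteq> j"
        using exists_other_index by blast
      then have "(affine_domain i, affine_coord i j) \<in> charts CP1"
        by (auto simp: charts_CP1)
      with i show ?thesis by force
    qed
    then show ?thesis by auto
  qed
  show "bij_betw Psi (points CP1) S2T"
    using inj_Psi range_Psi by (simp add: bij_betw_def)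
  fix c :: "(cp1, complex) chart" assume "c \<in> charts CP1"
  then obtain i j where ij: "i \<noteq> j" and c: "c = (affine_domain i, affine_coord i j)"
    by (auto simp: charts_CP1)
  have img: "snd c ` fst c = UNIV" and inv: "chart_inv c = (\<lambda>z. proj_point (affine_vector i z))"
    by (simp_all add: c image_affine_coord[OF ij] inv_into_affine_coord[OF ij])
  show "openin (top_of_set (points CP1)) (fst c)"
    by (simp add: c open_affine_domain)
  show "open (snd c ` fst c)"
    by (simp add: img)
  show "homeomorphism (fst c) (snd c ` fst c) (snd c) (chart_inv c)"
    unfolding img inv using homeomorphism_affine_coord[OF ij] by (simp add: c)
  show "smooth_on (snd c ` fst c) (\<lambda>z. Psi (chart_inv c z))"
    unfolding img inv Psi_proj_point[OF affine_vector_nonzero]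
    by (intro smooth_on_add smooth_on_const smooth_on_scaleR smooth_on_inverse smooth_on_inner
        smooth_on_hopf smooth_on_affine_vector[OF ij] open_UNIV) simp
  have "Psi ` affine_domain i = S2T \<inter> stereographic_domain i"
    unfolding range_Psi[symmetric]
    by (auto simp: Psi_mem_stereographic_domain)
  then show "\<exists>W g. open W \<and> Psi ` fst c = S2T \<inter> W \<and> smooth_on W g \<and> (\<forall>q\<in>fst c. g (Psi q) = snd c q)"
    using open_stereographic_domain smooth_on_stereographic stereographic_Psi[OF ij]
    by (intro exI[of _ "stereographic_domain i"] exI[of _ "stereographic i"]) (simp add: c)
next
  have "linear (\<lambda>z. vector [Re z, Im z] :: real^2)"
    by (rule linearI) (simp_all add: vec_eq_iff forall_2)
  then show "bounded_linear (\<lambda>z. vector [Re z, Im z] :: real^2)"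
    by (simp add: linear_conv_bounded_linear)
  have "linear (\<lambda>w :: real^2. Complex (w $ 1) (w $ 2))"
    by (rule linearI) (simp_all add: complex_eq_iff)
  then show "bounded_linear (\<lambda>w :: real^2. Complex (w $ 1) (w $ 2))"
    by (simp add: linear_conv_bounded_linear)
  fix z :: complex and w :: "real^2"
  show "Complex ((vector [Re z, Im z] :: real^2) $ 1) ((vector [Re z, Im z] :: real^2) $ 2) = z"
    by simp
  show "vector [Re (Complex (w $ 1) (w $ 2)), Im (Complex (w $ 1) (w $ 2))] = w"
    by (simp add: vec_eq_iff forall_2)
qed

section \<open>The Fubini--Study metric\<close>

lemma inner_hopf_derivative:
  assumes "v \<bullet> v = 1" "v \<bullet> w = 0"
  shows "hopf_derivative v w \<bullet> hopf_derivative v w = 4 * (Re (braket w w) - (cmod (braket v w))\<^sup>2)"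
proof -
  \<comment> \<open>A polynomial identity in real and imaginary parts, valid for all
    \<open>v\<close> and \<open>w\<close>. Here \<open>v \<bullet> w\<close> is the real part of
    \<open>braket v w\<close>.\<close>
  have "hopf_derivative v w \<bullet> hopf_derivative v w =
      4 * ((v \<bullet> v) * Re (braket w w) - (cmod (braket v w))\<^sup>2) + 4 * (v \<bullet> w)\<^sup>2"
    unfolding hopf_derivative_def inner_trunc_combination_self cmod_power2 inner_complex_vec2 inner_complex_def braket_def sum_2
    by (simp add: power2_eq_square algebra_simps)
  with assms show ?thesis by simp
qed

text \<open>Without a witness the choice in \<open>ds2_FS\<close> would be unconstrained.
  Normalising the affine representative gives a lift over a whole affine domain.\<close>

lemma exists_unit_lift: "\<exists>\<psi> U. p \<in> U \<and> unit_lift U \<psi>"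
proof -
  obtain i where i: "p \<in> affine_domain i"
    using affine_domain_cover by blast
  obtain j where ij: "i \<noteq> j"
    using exists_other_index by blast
  let ?U = "affine_domain i"
  define u where "u = (\<lambda>z. inverse (sqrt (affine_vector i z \<bullet> affine_vector i z)) *\<^sub>R affine_vector i z)"
  define \<psi> where "\<psi> = (\<lambda>q. u (affine_coord i j q))"
  have u: "smooth_on UNIV u"
    unfolding u_def
    by (intro smooth_on_scaleR smooth_on_inverse smooth_on_sqrt smooth_on_inner
        smooth_on_affine_vector[OF ij] open_UNIV) simp_all
  have chart: "(?U, affine_coord i j) \<in> charts CP1"
    using ij by (auto simp: charts_CP1)
  have "\<psi> q \<in> line_of q \<and> norm (\<psi> q) = 1" if "q \<in> ?U" for q
  proof
    have "u z \<in> line_of (proj_point (affine_vector i z))" for z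
      unfolding u_def scaleR_eq_smult mem_line_of_proj_point[OF affine_vector_nonzero] by blast
    then show "\<psi> q \<in> line_of q"
      using affine_vector_affine_coord[OF ij that] unfolding \<psi>_def by metis
    show "norm (\<psi> q) = 1"
      by (simp add: \<psi>_def u_def norm_eq_sqrt_inner[symmetric])
  qed
  moreover have "smooth_map (open_submanifold CP1 ?U) euclidean_manifold \<psi>"
    unfolding smooth_map_def
  proof (intro conjI ballI)
    show "\<psi> ` points (open_submanifold CP1 ?U) \<subseteq> points euclidean_manifold"
      by (simp add: euclidean_manifold_def)
    show "continuous_on (points (open_submanifold CP1 ?U)) \<psi>"
      unfolding \<psi>_def
      by (rule continuous_on_compose2[OF smooth_on_imp_continuous_on[OF u]])
        (simp_all add: open_submanifold_def continuous_on_affine_coord)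
    fix c' d assume "c' \<in> charts (open_submanifold CP1 ?U)"
      and "d \<in> charts (euclidean_manifold :: (complex^2, complex^2) manifold)"
    then obtain c where c: "c \<in> charts CP1" "c' = (fst c \<inter> ?U, snd c)" and d: "d = (UNIV, \<lambda>x. x)"
      by (auto simp: open_submanifold_def euclidean_manifold_def)
    let ?V = "snd c ` (fst c \<inter> ?U)"
    have "?V = snd c ` fst c \<inter> chart_inv c -` ?U"
      by (rule image_chart_Int[OF Psi.chart_inj[OF c(1)]])
    then have op: "open ?V"
      using continuous_open_preimage[OF _ Psi.chart_open[OF c(1)] open_affine_domain]
        Psi.chart_homeomorphism[OF c(1)] by (simp add: homeomorphism_def)
    \<comment> \<open>In an arbitrary chart the lift is a coordinate change of the atlas followed by
      \<open>u\<close>.\<close>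
    have "smooth_on ?V (affine_coord i j \<circ> chart_inv c)"
      using Psi.smooth_manifold c(1) chart unfolding smooth_manifold_def by fastforce
    then have "smooth_on ?V (\<lambda>z. u ((affine_coord i j \<circ> chart_inv c) z))"
      by (rule smooth_on_compose[OF op open_UNIV subset_UNIV _ u])
    \<comment> \<open>Restricting the chart changes its \<open>inv_into\<close>; the two inverses
      agree on the coordinate image of the overlap.\<close>
    moreover have "u ((affine_coord i j \<circ> chart_inv c) z) = (snd d \<circ> \<psi> \<circ> chart_inv c') z"
      if "z \<in> ?V" for z
      using that Psi.chart_inj[OF c(1)] inj_on_subset[OF Psi.chart_inj[OF c(1)], of "fst c \<inter> ?U"]
      by (auto simp: c(2) d \<psi>_def inv_into_f_f)
    ultimately have "smooth_on ?V (snd d \<circ> \<psi> \<circ> chart_inv c')"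
      by (rule iffD1[OF smooth_on_cong[OF op], rotated])
    then show "smooth_on (snd c' ` (fst c' \<inter> \<psi> -` fst d)) (snd d \<circ> \<psi> \<circ> chart_inv c')"
      by (simp add: c(2) d)
  qed
  ultimately have "unit_lift ?U \<psi>"
    unfolding unit_lift_def using open_affine_domain by simp
  with i show ?thesis by blast
qed

text \<open>Stated for every lift, because the one selected in \<open>ds2_FS\<close> is known only
  to be a lift. Both differentials use the same selected chart, so the chain rule compares them
  directly.\<close>

lemma inner_differential_Psi:
  assumes p: "p \<in> U" and \<psi>: "unit_lift U \<psi>"
  defines "d\<psi> \<equiv> \<lambda>v. euclidean_vector (differential CP1 euclidean_manifold \<psi> p v)"
    and "d\<Psi> \<equiv> \<lambda>v. euclidean_vector (differential CP1 euclidean_manifold Psi p v)"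
  shows "d\<Psi> v \<bullet> d\<Psi> v = 4 * (Re (braket (d\<psi> v) (d\<psi> v)) - (cmod (braket (\<psi> p) (d\<psi> v)))\<^sup>2)"
proof -
  define c where "c = (SOME c. c \<in> charts_at CP1 p)"
  have c: "c \<in> charts CP1" "p \<in> fst c"
    using Psi.someI_charts_at[of p] by (simp_all add: c_def)
  note inj = Psi.chart_inj[OF c(1)]
  let ?V = "snd c ` (fst c \<inter> U)"
  have unit: "\<psi> q \<in> line_of q" "norm (\<psi> q) = 1" if "q \<in> U" for q
    using \<psi> that by (simp_all add: unit_lift_def)
  have "?V = snd c ` fst c \<inter> chart_inv c -` U"
    by (rule image_chart_Int[OF inj])
  then have op: "open ?V"
    using continuous_open_preimage[OF _ Psi.chart_open[OF c(1)], of "chart_inv c" U]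
      Psi.chart_homeomorphism[OF c(1)] \<psi> by (simp add: homeomorphism_def unit_lift_def)
  have pV: "snd c p \<in> ?V"
    using c p by blast
  have mem: "chart_inv c z \<in> U" if "z \<in> ?V" for z
    using that inj by (auto simp: inv_into_f_f)
  have cp: "chart_inv c (snd c p) = p"
    using c inj by (simp add: inv_into_f_f)
  have "smooth_on ?V (\<psi> \<circ> inv_into (fst c \<inter> U) (snd c))"
    using \<psi> c(1) unfolding unit_lift_def smooth_map_def
    by (force simp: open_submanifold_def euclidean_manifold_def comp_def)
  moreover have "(\<psi> \<circ> inv_into (fst c \<inter> U) (snd c)) z = \<psi> (chart_inv c z)" if "z \<in> ?V" for z
    using that inj inj_on_subset[OF inj, of "fst c \<inter> U"] by (auto simp: inv_into_f_f)
  ultimately have "smooth_on ?V (\<lambda>z. \<psi> (chart_inv c z))"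
    by (rule iffD1[OF smooth_on_cong[OF op], rotated])
  from smooth_on_has_derivative[OF this pV]
  have D: "((\<lambda>z. \<psi> (chart_inv c z)) has_derivative
      frechet_derivative (\<lambda>z. \<psi> (chart_inv c z)) (at (snd c p))) (at (snd c p))"
    (is "(_ has_derivative ?D) _") .
  have d\<psi>: "d\<psi> v = ?D (v c)" for v
    unfolding d\<psi>_def by (simp add: euclidean_vector_differential c_def[symmetric] comp_def)
  have "((\<lambda>x :: complex^2. (1/2) *\<^sub>R 1 + hopf x) has_derivative hopf_derivative (\<psi> p)) (at (\<psi> p))"
    using has_derivative_add[OF has_derivative_const hopf_has_derivative] by simp
  then have "frechet_derivative (\<lambda>z. Psi (chart_inv c z)) (at (snd c p)) (v c) =
      hopf_derivative (\<psi> p) (?D (v c))"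
    by (intro frechet_derivative_compose_at[OF D _ op pV])
      (use cp Psi_unit unit mem in auto)
  then have "d\<Psi> v = hopf_derivative (\<psi> p) (d\<psi> v)"
    unfolding d\<Psi>_def d\<psi> by (simp add: euclidean_vector_differential c_def[symmetric] comp_def)
  moreover have norm1: "\<psi> q \<bullet> \<psi> q = 1" if "q \<in> U" for q
    using unit(2)[OF that] by (simp add: norm_eq_1)
  \<comment> \<open>The squared norm of the lift is the constant 1. Its derivative kills only the
    real part of \<open>braket (\<psi> p) (d\<psi> v)\<close>; the imaginary part depends on the
    phase of the lift and is what the Fubini-Study form subtracts.\<close>
  have "((\<lambda>x :: complex^2. x \<bullet> x) has_derivative (\<lambda>w. \<psi> p \<bullet> w + w \<bullet> \<psi> p)) (at (\<psi> p))"
    by (rule has_derivative_inner[OF has_derivative_ident has_derivative_ident])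
  then have "frechet_derivative (\<lambda>z. 1 :: real) (at (snd c p)) (v c) =
      \<psi> p \<bullet> ?D (v c) + ?D (v c) \<bullet> \<psi> p"
    by (intro frechet_derivative_compose_at[where g = "\<lambda>x. x \<bullet> x", OF D _ op pV])
      (simp_all only: cp norm1 mem)
  then have "\<psi> p \<bullet> d\<psi> v = 0"
    unfolding d\<psi> by (simp add: inner_commute)
  ultimately show ?thesis
    using inner_hopf_derivative[OF norm1[OF p]] by simp
qed

theorem mainTheorem1:
  shows "smooth_embedding CP1 (euclidean_manifold :: (trunc, trunc) manifold) Psi \<and>
         diffeomorphism CP1 S2T_manifold Psi \<and>
         compact S2T \<and> S2T = sphere (of_real (1/2)) 1 \<and>
         (\<forall>p. \<forall>v\<in>tangent_space CP1 p.
            ds2_T (Psi p) (differential CP1 S2T_manifold Psi p v) = 4 * ds2_FS p v)"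
proof (intro conjI allI ballI)
  show "smooth_embedding CP1 euclidean_manifold Psi"
    by (rule Psi.smooth_embedding)
  show "diffeomorphism CP1 S2T_manifold Psi"
    unfolding S2T_manifold_def by (rule Psi.diffeomorphism)
  show "compact S2T"
    unfolding S2T_eq_sphere by (rule compact_sphere)
  show "S2T = sphere (of_real (1/2)) 1"
    by (rule S2T_eq_sphere)
  fix p v
  \<comment> \<open>Exactly the choice inside \<open>ds2_FS\<close>, so that it can be folded
    there.\<close>
  define \<psi> where "\<psi> = (SOME \<psi>. \<exists>U. p \<in> U \<and> unit_lift U \<psi>)"
  have "\<exists>U. p \<in> U \<and> unit_lift U \<psi>"
    unfolding \<psi>_def by (rule someI_ex[OF exists_unit_lift])
  then obtain U where "p \<in> U" "unit_lift U \<psi>"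
    by blast
  then show "ds2_T (Psi p) (differential CP1 S2T_manifold Psi p v) = 4 * ds2_FS p v"
    using inner_differential_Psi Psi.euclidean_vector_inclusion_differential[of p v]
    unfolding ds2_T_def ds2_FS_def S2T_manifold_def Let_def \<psi>_def[symmetric] by simp
qed

end
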